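(* Assume that $\alpha(s)=\psi(u(s),v(s))$ is a loxodrome, parametrized by arc length, on a $G_X$-invariant surface $M\subset(N^3,g)$ locally defined by $\psi(u,v)=\phi_v(\gamma(u))$, making the constant angle $\vartheta_0$ with $X$, where $\vartheta_0\neq 0,\pi/2$. If $\alpha$ is a geodesic of $M$, then the surface is flat.
   Context: $(N^3,g)$ is a three-dimensional Riemannian manifold, $X$ a Killing vector field on $N$, $G_X$ the one-parameter group of isometries generated by $X$, and $\phi_v$ the local flow of $X$. $N_r\subset N$ is the regular part (the set of points belonging to principal orbits of $G_X$). The quotient $N_r/G_X$ carries the quotient metric $\tilde g$ making $\pi:N_r\to N_r/G_X$ a Riemannian submersion. A $G_X$-invariant surface is the image in $N_r$ of an immersion $f:M\to N$ for which there is an action of $G_X$ on $M$ with $f(ax)=af(x)$ for all $a\in G_X$, $x\in M$; $M$ carries the induced metric, and "flat" means that the Gauss curvature of this metric is zero. Locally the surface is parametrized by $\psi(u,v)=\phi_v(\gamma(u))$, $(u,v)\in I\times(-\epsilon,\epsilon)$, $I$ an open interval, where $\tilde\gamma:I\to (N_r/G_X,\tilde g)$ is a curve parametrized by arc length (the profile curve) and $\gamma:I\to N$ is a lift of it, i.e. $d\pi(\gamma')=\tilde\gamma'$. Put $\omega(u)=\|X(\gamma(u))\|_g$. A loxodrome on $M$ is a curve on $M$ making a constant angle $\vartheta_0\in[0,\pi)$ with $X$; if $\alpha$ is its arc-length parametrization this means $g(\alpha',X)=\omega\cos\vartheta_0$.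
   Formalization: Flatness is concluded only on the part of the surface made of the orbits that the loxodrome α meets, since a short arc α on a cylindrical piece of an otherwise curved invariant surface shows that the whole surface need not be flat. *)

theory Defs
  imports "HOL-Analysis.Analysis"
begin

section \<open>Smooth functions on open subsets of Euclidean spaces\<close>

text \<open>All sets \<open>S\<close> below are open. The recursion differentiates in a fixed direction, so that the
  type of the function does not change; over a Euclidean space this is ordinary \<open>C\<^sup>k\<close>.\<close>

primrec Ck_on :: "nat \<Rightarrow> 'a::euclidean_space set \<Rightarrow> ('a \<Rightarrow> 'b::real_normed_vector) \<Rightarrow> bool" where
  "Ck_on 0 S f \<longleftrightarrow> continuous_on S f"
| "Ck_on (Suc k) S f \<longleftrightarrow>
     (\<forall>z\<in>S. f differentiable (at z)) \<and> (\<forall>a. Ck_on k S (\<lambda>z. frechet_derivative f (at z) a))"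

definition smooth_on :: "'a::euclidean_space set \<Rightarrow> ('a \<Rightarrow> 'b::real_normed_vector) \<Rightarrow> bool" where
  "smooth_on S f \<longleftrightarrow> (\<forall>k. Ck_on k S f)"

definition partial :: "'d \<Rightarrow> (real^'d::finite \<Rightarrow> real) \<Rightarrow> real^'d \<Rightarrow> real" where
  "partial i F z = frechet_derivative F (at z) (axis i 1)"


section \<open>Smooth manifolds\<close>

text \<open>A chart is a domain together with a coordinate map, which is only relevant on the domain.\<close>

type_synonym ('p, 'd) chart = "'p set \<times> ('p \<Rightarrow> real^'d)"

definition transition :: "('p, 'd::finite) chart \<Rightarrow> ('p, 'e::finite) chart \<Rightarrow> real^'d \<Rightarrow> real^'e" where
  "transition c e = snd e \<circ> inv_into (fst c) (snd c)"

definition is_chart :: "'p topology \<Rightarrow> ('p, 'd::finite) chart \<Rightarrow> bool" where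
  "is_chart T c \<longleftrightarrow> openin T (fst c) \<and> open (snd c ` fst c) \<and>
     homeomorphic_map (subtopology T (fst c)) (top_of_set (snd c ` fst c)) (snd c)"

definition compatible :: "('p, 'd::finite) chart \<Rightarrow> ('p, 'd) chart \<Rightarrow> bool" where
  "compatible c e \<longleftrightarrow>
     smooth_on (snd c ` (fst c \<inter> fst e)) (transition c e) \<and>
     smooth_on (snd e ` (fst c \<inter> fst e)) (transition e c)"

text \<open>The smooth structure is given by its maximal atlas.\<close>

definition smooth_manifold :: "'p topology \<Rightarrow> ('p, 'd::finite) chart set \<Rightarrow> bool" where
  "smooth_manifold T A \<longleftrightarrow> Hausdorff_space T \<and> second_countable T \<and>
     (\<Union>c\<in>A. fst c) = topspace T \<and>
     (\<forall>c\<in>A. is_chart T c) \<and> (\<forall>c\<in>A. \<forall>e\<in>A. compatible c e) \<and>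
     (\<forall>c. is_chart T c \<and> (\<forall>e\<in>A. compatible c e) \<longrightarrow> c \<in> A)"

text \<open>A smooth map defined on the open submanifold \<open>S\<close>.\<close>

definition smooth_map_on :: "'p topology \<Rightarrow> ('p, 'd::finite) chart set \<Rightarrow> 'p set \<Rightarrow>
    'q topology \<Rightarrow> ('q, 'e::finite) chart set \<Rightarrow> ('p \<Rightarrow> 'q) \<Rightarrow> bool" where
  "smooth_map_on T A S T' A' f \<longleftrightarrow>
     openin T S \<and> continuous_map (subtopology T S) T' f \<and>
     (\<forall>c\<in>A. \<forall>e\<in>A'. smooth_on (snd c ` {p \<in> fst c \<inter> S. f p \<in> fst e})
                         (snd e \<circ> f \<circ> inv_into (fst c) (snd c)))"

definition smooth_curve :: "'p topology \<Rightarrow> ('p, 'd::finite) chart set \<Rightarrow> real set \<Rightarrow> (real \<Rightarrow> 'p) \<Rightarrow> bool"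
  where "smooth_curve T A I \<gamma> \<longleftrightarrow>
     continuous_map (top_of_set I) T \<gamma> \<and>
     (\<forall>c\<in>A. smooth_on {t \<in> I. \<gamma> t \<in> fst c} (snd c \<circ> \<gamma>))"

definition open_interval :: "real set \<Rightarrow> bool" where
  "open_interval I \<longleftrightarrow> open I \<and> connected I"


section \<open>Tangent vectors\<close>

text \<open>A tangent vector at \<open>p\<close> is the family of its components in all charts of the atlas around \<open>p\<close>,
  related by the Jacobians of the transition maps; it is set to zero at all other charts.
  \<open>coord_vec A c p a\<close> is the vector at \<open>p\<close> with components \<open>a\<close> in the chart \<open>c\<close>.\<close>

type_synonym ('p, 'd) tvec = "('p, 'd) chart \<Rightarrow> real^'d"

definition coord_vec :: "('p, 'd::finite) chart set \<Rightarrow> ('p, 'd) chart \<Rightarrow> 'p \<Rightarrow> real^'d \<Rightarrow> ('p, 'd) tvec"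
  where "coord_vec A c p a = (\<lambda>e. if e \<in> A \<and> p \<in> fst e
            then frechet_derivative (transition c e) (at (snd c p)) a else 0)"

definition tangent_space :: "('p, 'd::finite) chart set \<Rightarrow> 'p \<Rightarrow> ('p, 'd) tvec set" where
  "tangent_space A p = {coord_vec A c p a | c a. c \<in> A \<and> p \<in> fst c}"

definition velocity :: "('p, 'd::finite) chart set \<Rightarrow> (real \<Rightarrow> 'p) \<Rightarrow> real \<Rightarrow> ('p, 'd) tvec" where
  "velocity A \<gamma> t = (\<lambda>e. if e \<in> A \<and> \<gamma> t \<in> fst e
      then vector_derivative (snd e \<circ> \<gamma>) (at t) else 0)"

definition chart_at :: "('p, 'd::finite) chart set \<Rightarrow> 'p \<Rightarrow> ('p, 'd) chart" where
  "chart_at A p = (SOME c. c \<in> A \<and> p \<in> fst c)"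

text \<open>The differential of \<open>f\<close> at \<open>p\<close>. By the chain rule the choice of the chart \<open>c\<close> around \<open>p\<close> is
  irrelevant.\<close>

definition differential :: "('p, 'd::finite) chart set \<Rightarrow> ('q, 'e::finite) chart set \<Rightarrow> ('p \<Rightarrow> 'q) \<Rightarrow>
    'p \<Rightarrow> ('p, 'd) tvec \<Rightarrow> ('q, 'e) tvec" where
  "differential A A' f p v = (let c = chart_at A p in
     (\<lambda>e. if e \<in> A' \<and> f p \<in> fst e
       then frechet_derivative (snd e \<circ> f \<circ> inv_into (fst c) (snd c)) (at (snd c p)) (v c) else 0))"

definition immersion :: "'p topology \<Rightarrow> ('p, 'd::finite) chart set \<Rightarrow>
    'q topology \<Rightarrow> ('q, 'e::finite) chart set \<Rightarrow> ('p \<Rightarrow> 'q) \<Rightarrow> bool" where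
  "immersion T A T' A' f \<longleftrightarrow> smooth_map_on T A (topspace T) T' A' f \<and>
     (\<forall>p\<in>topspace T. inj_on (differential A A' f p) (tangent_space A p))"


section \<open>Riemannian metrics\<close>

type_synonym ('p, 'd) metric_tensor = "'p \<Rightarrow> ('p, 'd) tvec \<Rightarrow> ('p, 'd) tvec \<Rightarrow> real"

text \<open>The components \<open>g\<^sub>i\<^sub>j\<close> in the chart \<open>c\<close>, as functions of the coordinates.\<close>

definition metric_comp :: "('p, 'd::finite) chart set \<Rightarrow> ('p, 'd) metric_tensor \<Rightarrow> ('p, 'd) chart \<Rightarrow>
    real^'d \<Rightarrow> real^'d^'d" where
  "metric_comp A g c z = (let p = inv_into (fst c) (snd c) z in
     \<chi> i j. g p (coord_vec A c p (axis i 1)) (coord_vec A c p (axis j 1)))"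

definition riemannian_metric :: "'p topology \<Rightarrow> ('p, 'd::finite) chart set \<Rightarrow> ('p, 'd) metric_tensor \<Rightarrow> bool"
  where "riemannian_metric T A g \<longleftrightarrow>
     (\<forall>c\<in>A. \<forall>p\<in>fst c. bilinear (\<lambda>a b. g p (coord_vec A c p a) (coord_vec A c p b))) \<and>
     (\<forall>p\<in>topspace T. \<forall>v\<in>tangent_space A p. \<forall>w\<in>tangent_space A p. g p v w = g p w v) \<and>
     (\<forall>p\<in>topspace T. \<forall>v\<in>tangent_space A p. v \<noteq> (\<lambda>_. 0) \<longrightarrow> g p v v > 0) \<and>
     (\<forall>c\<in>A. smooth_on (snd c ` fst c) (metric_comp A g c))"

definition riemannian_manifold :: "'p topology \<Rightarrow> ('p, 'd::finite) chart set \<Rightarrow> ('p, 'd) metric_tensor \<Rightarrow> bool"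
  where "riemannian_manifold T A g \<longleftrightarrow> smooth_manifold T A \<and> riemannian_metric T A g"

definition tnorm :: "('p, 'd) metric_tensor \<Rightarrow> 'p \<Rightarrow> ('p, 'd) tvec \<Rightarrow> real" where
  "tnorm g p v = sqrt (g p v v)"

definition induced_metric :: "('p, 'd::finite) chart set \<Rightarrow> ('q, 'e::finite) chart set \<Rightarrow> ('p \<Rightarrow> 'q) \<Rightarrow>
    ('q, 'e) metric_tensor \<Rightarrow> ('p, 'd) metric_tensor" where
  "induced_metric A A' f g p v w = g (f p) (differential A A' f p v) (differential A A' f p w)"

definition arclength_parametrized :: "('p, 'd::finite) chart set \<Rightarrow> ('p, 'd) metric_tensor \<Rightarrow>
    real set \<Rightarrow> (real \<Rightarrow> 'p) \<Rightarrow> bool" where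
  "arclength_parametrized A g I \<gamma> \<longleftrightarrow> (\<forall>t\<in>I. tnorm g (\<gamma> t) (velocity A \<gamma> t) = 1)"

text \<open>The coordinate Christoffel symbol with upper index \<open>k\<close> and lower indices \<open>i\<close>, \<open>j\<close>.\<close>

definition christoffel :: "(real^'d::finite \<Rightarrow> real^'d^'d) \<Rightarrow> real^'d \<Rightarrow> 'd \<Rightarrow> 'd \<Rightarrow> 'd \<Rightarrow> real" where
  "christoffel h z k i j = (1/2) * (\<Sum>l\<in>UNIV. matrix_inv (h z) $ k $ l *
     (partial i (\<lambda>w. h w $ j $ l) z + partial j (\<lambda>w. h w $ i $ l) z - partial l (\<lambda>w. h w $ i $ j) z))"

definition geodesic :: "('p, 'd::finite) chart set \<Rightarrow> ('p, 'd) metric_tensor \<Rightarrow>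
    real set \<Rightarrow> (real \<Rightarrow> 'p) \<Rightarrow> bool" where
  "geodesic A g J \<alpha> \<longleftrightarrow> (\<forall>c\<in>A. \<forall>s\<in>J. \<alpha> s \<in> fst c \<longrightarrow>
     (let y = snd c \<circ> \<alpha>; y' = (\<lambda>t. vector_derivative y (at t)); y'' = (\<lambda>t. vector_derivative y' (at t))
      in \<forall>k. y'' s $ k +
           (\<Sum>i\<in>UNIV. \<Sum>j\<in>UNIV. christoffel (metric_comp A g c) (y s) k i j * y' s $ i * y' s $ j) = 0))"

text \<open>\<open>riemann h z l k i j\<close> is the component along \<open>\<partial>\<^sub>l\<close> of \<open>R(\<partial>\<^sub>i, \<partial>\<^sub>j) \<partial>\<^sub>k\<close>, where
  \<open>R(X,Y) = [\<nabla>\<^sub>X, \<nabla>\<^sub>Y] - \<nabla>\<^sub>[\<^sub>X\<^sub>,\<^sub>Y\<^sub>]\<close>.\<close>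

definition riemann :: "(real^'d::finite \<Rightarrow> real^'d^'d) \<Rightarrow> real^'d \<Rightarrow> 'd \<Rightarrow> 'd \<Rightarrow> 'd \<Rightarrow> 'd \<Rightarrow> real" where
  "riemann h z l k i j =
     partial i (\<lambda>w. christoffel h w l j k) z - partial j (\<lambda>w. christoffel h w l i k) z +
     (\<Sum>m\<in>UNIV. christoffel h z l i m * christoffel h z m j k - christoffel h z l j m * christoffel h z m i k)"

text \<open>The Gauss curvature \<open>g(R(\<partial>\<^sub>1, \<partial>\<^sub>2) \<partial>\<^sub>2, \<partial>\<^sub>1) / (g\<^sub>1\<^sub>1 g\<^sub>2\<^sub>2 - g\<^sub>1\<^sub>2\<^sup>2)\<close>, which does not depend on the chart.\<close>

definition gauss_curvature_coord :: "(real^2 \<Rightarrow> real^2^2) \<Rightarrow> real^2 \<Rightarrow> real" where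
  "gauss_curvature_coord h z = (\<Sum>l\<in>UNIV. h z $ 1 $ l * riemann h z l 2 1 2) / det (h z)"

definition gauss_curvature :: "('p, 2) chart set \<Rightarrow> ('p, 2) metric_tensor \<Rightarrow> 'p \<Rightarrow> real" where
  "gauss_curvature A g p =
     (let c = chart_at A p in gauss_curvature_coord (metric_comp A g c) (snd c p))"

definition flat_on :: "('p, 2) chart set \<Rightarrow> ('p, 2) metric_tensor \<Rightarrow> 'p set \<Rightarrow> bool" where
  "flat_on A g S \<longleftrightarrow> (\<forall>p\<in>S. gauss_curvature A g p = 0)"

text \<open>The differential is an isometry from the orthogonal complement of its kernel onto the tangent
  space of the base.\<close>

definition riemannian_submersion_on :: "'p topology \<Rightarrow> ('p, 'd::finite) chart set \<Rightarrow> ('p, 'd) metric_tensor \<Rightarrow>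
    'p set \<Rightarrow> 'q topology \<Rightarrow> ('q, 'e::finite) chart set \<Rightarrow> ('q, 'e) metric_tensor \<Rightarrow> ('p \<Rightarrow> 'q) \<Rightarrow> bool" where
  "riemannian_submersion_on T A g S T' A' g' \<pi> \<longleftrightarrow>
     smooth_map_on T A S T' A' \<pi> \<and>
     (\<forall>p\<in>S. let D = differential A A' \<pi> p;
               H = {v \<in> tangent_space A p. \<forall>k\<in>tangent_space A p. D k = (\<lambda>_. 0) \<longrightarrow> g p v k = 0}
            in D ` tangent_space A p = tangent_space A' (\<pi> p) \<and>
               (\<forall>v\<in>H. \<forall>w\<in>H. g' (\<pi> p) (D v) (D w) = g p v w))"


section \<open>Killing fields and their one-parameter groups\<close>

type_synonym ('p, 'd) vfield = "'p \<Rightarrow> ('p, 'd) tvec"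

definition vfield_comp :: "('p, 'd::finite) vfield \<Rightarrow> ('p, 'd) chart \<Rightarrow> real^'d \<Rightarrow> real^'d" where
  "vfield_comp X c z = X (inv_into (fst c) (snd c) z) c"

definition smooth_vfield :: "'p topology \<Rightarrow> ('p, 'd::finite) chart set \<Rightarrow> ('p, 'd) vfield \<Rightarrow> bool" where
  "smooth_vfield T A X \<longleftrightarrow> (\<forall>p\<in>topspace T. X p \<in> tangent_space A p) \<and>
     (\<forall>c\<in>A. smooth_on (snd c ` fst c) (vfield_comp X c))"

text \<open>The Lie derivative of the metric along \<open>X\<close> vanishes:
  \<open>X\<^sup>k \<partial>\<^sub>k g\<^sub>i\<^sub>j + g\<^sub>k\<^sub>j \<partial>\<^sub>i X\<^sup>k + g\<^sub>i\<^sub>k \<partial>\<^sub>j X\<^sup>k = 0\<close> in every chart.\<close>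

definition killing_field :: "'p topology \<Rightarrow> ('p, 'd::finite) chart set \<Rightarrow> ('p, 'd) metric_tensor \<Rightarrow>
    ('p, 'd) vfield \<Rightarrow> bool" where
  "killing_field T A g X \<longleftrightarrow> smooth_vfield T A X \<and>
     (\<forall>c\<in>A. \<forall>z\<in>snd c ` fst c. \<forall>i j.
        let h = metric_comp A g c; \<xi> = vfield_comp X c in
        (\<Sum>k\<in>UNIV. \<xi> z $ k * partial k (\<lambda>w. h w $ i $ j) z
                + h z $ k $ j * partial i (\<lambda>w. \<xi> w $ k) z
                + h z $ i $ k * partial j (\<lambda>w. \<xi> w $ k) z) = 0)"

text \<open>A smooth action of the additive group of the reals.\<close>

definition smooth_real_action :: "'p topology \<Rightarrow> ('p, 'd::finite) chart set \<Rightarrow> (real \<Rightarrow> 'p \<Rightarrow> 'p) \<Rightarrow> bool"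
  where "smooth_real_action T A \<phi> \<longleftrightarrow>
     (\<forall>p\<in>topspace T. \<phi> 0 p = p) \<and>
     (\<forall>s t. \<forall>p\<in>topspace T. \<phi> (s + t) p = \<phi> s (\<phi> t p)) \<and>
     continuous_map (prod_topology euclideanreal T) T (\<lambda>(t, p). \<phi> t p) \<and>
     (\<forall>c\<in>A. \<forall>e\<in>A. smooth_on {(t, z). z \<in> snd c ` fst c \<and> \<phi> t (inv_into (fst c) (snd c) z) \<in> fst e}
                         (\<lambda>(t, z). snd e (\<phi> t (inv_into (fst c) (snd c) z))))"

text \<open>\<open>\<phi>\<close> is the flow of \<open>X\<close>; the maps \<open>\<phi> t\<close> form the one-parameter group \<open>G\<^sub>X\<close> generated by \<open>X\<close>
  (for a Killing field these are isometries).\<close>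

definition flow_of :: "'p topology \<Rightarrow> ('p, 'd::finite) chart set \<Rightarrow> ('p, 'd) vfield \<Rightarrow>
    (real \<Rightarrow> 'p \<Rightarrow> 'p) \<Rightarrow> bool" where
  "flow_of T A X \<phi> \<longleftrightarrow> smooth_real_action T A \<phi> \<and>
     (\<forall>t. \<forall>p\<in>topspace T. velocity A (\<lambda>r. \<phi> r p) t = X (\<phi> t p))"

definition orbit :: "(real \<Rightarrow> 'p \<Rightarrow> 'p) \<Rightarrow> 'p \<Rightarrow> 'p set" where
  "orbit \<phi> p = range (\<lambda>t. \<phi> t p)"

definition stabilizer :: "(real \<Rightarrow> 'p \<Rightarrow> 'p) \<Rightarrow> 'p \<Rightarrow> real set" where
  "stabilizer \<phi> p = {t. \<phi> t p = p}"

text \<open>The orbit of \<open>p\<close> is principal if the isotropy group of \<open>p\<close> is, up to moving the points along their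
  orbits, contained in the isotropy groups of all nearby points.\<close>

definition regular_part :: "'p topology \<Rightarrow> (real \<Rightarrow> 'p \<Rightarrow> 'p) \<Rightarrow> 'p set" where
  "regular_part T \<phi> = {p \<in> topspace T. \<exists>V. openin T V \<and> p \<in> V \<and>
     (\<forall>q\<in>V. \<exists>a. stabilizer \<phi> p \<subseteq> stabilizer \<phi> (\<phi> a q))}"

text \<open>The orbit space of the regular part, whose points are the orbits and whose projection is
  \<open>orbit \<phi>\<close>, with a smooth structure and a metric for which the projection is a Riemannian submersion.\<close>

definition riemannian_orbit_space :: "'p topology \<Rightarrow> ('p, 'd::finite) chart set \<Rightarrow> ('p, 'd) metric_tensor \<Rightarrow>
    (real \<Rightarrow> 'p \<Rightarrow> 'p) \<Rightarrow> 'p set topology \<Rightarrow> ('p set, 'e::finite) chart set \<Rightarrow> ('p set, 'e) metric_tensor \<Rightarrow> bool"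
  where "riemannian_orbit_space T A g \<phi> TB AB gB \<longleftrightarrow>
     riemannian_manifold TB AB gB \<and>
     quotient_map (subtopology T (regular_part T \<phi>)) TB (orbit \<phi>) \<and>
     riemannian_submersion_on T A g (regular_part T \<phi>) TB AB gB (orbit \<phi>)"


section \<open>Invariant surfaces\<close>

text \<open>An immersed surface in the regular part with an equivariant action of \<open>G\<^sub>X\<close>, written as an action
  \<open>\<tau>\<close> of the reals. The group \<open>G\<^sub>X\<close> is the quotient of the reals by the parameters that act trivially
  on the ambient manifold, so \<open>\<tau>\<close> must factor through this quotient.\<close>

definition invariant_surface :: "'n topology \<Rightarrow> ('n, 'd::finite) chart set \<Rightarrow> (real \<Rightarrow> 'n \<Rightarrow> 'n) \<Rightarrow>
    'm topology \<Rightarrow> ('m, 2) chart set \<Rightarrow> ('m \<Rightarrow> 'n) \<Rightarrow> (real \<Rightarrow> 'm \<Rightarrow> 'm) \<Rightarrow> bool" where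
  "invariant_surface T A \<phi> TM AM f \<tau> \<longleftrightarrow>
     smooth_manifold TM AM \<and> immersion TM AM T A f \<and>
     f ` topspace TM \<subseteq> regular_part T \<phi> \<and>
     smooth_real_action TM AM \<tau> \<and>
     (\<forall>s t. (\<forall>p\<in>topspace T. \<phi> s p = \<phi> t p) \<longrightarrow> (\<forall>x\<in>topspace TM. \<tau> s x = \<tau> t x)) \<and>
     (\<forall>t. \<forall>x\<in>topspace TM. f (\<tau> t x) = \<phi> t (f x))"

text \<open>\<open>\<gamma>\<close> is a lift to the regular part of the profile curve \<open>\<gamma>B\<close> in the orbit space, which is
  parametrized by arc length.\<close>

definition profile_lift :: "'n topology \<Rightarrow> ('n, 'd::finite) chart set \<Rightarrow> (real \<Rightarrow> 'n \<Rightarrow> 'n) \<Rightarrow>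
    'n set topology \<Rightarrow> ('n set, 'e::finite) chart set \<Rightarrow> ('n set, 'e) metric_tensor \<Rightarrow>
    real set \<Rightarrow> (real \<Rightarrow> 'n set) \<Rightarrow> (real \<Rightarrow> 'n) \<Rightarrow> bool" where
  "profile_lift T A \<phi> TB AB gB I \<gamma>B \<gamma> \<longleftrightarrow>
     smooth_curve TB AB I \<gamma>B \<and> arclength_parametrized AB gB I \<gamma>B \<and>
     smooth_curve T A I \<gamma> \<and> \<gamma> ` I \<subseteq> regular_part T \<phi> \<and>
     (\<forall>r\<in>I. orbit \<phi> (\<gamma> r) = \<gamma>B r \<and>
            differential A AB (orbit \<phi>) (\<gamma> r) (velocity A \<gamma> r) = velocity AB \<gamma>B r)"

text \<open>The local parametrization \<open>\<psi>(u,v) = \<phi>\<^sub>v(\<gamma>(u))\<close> on \<open>I \<times> (-\<epsilon>,\<epsilon>)\<close>, given by its inverse: a chart \<open>c\<close>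
  of the surface with coordinates \<open>(u,v)\<close>.\<close>

definition invariant_chart :: "(real \<Rightarrow> 'n \<Rightarrow> 'n) \<Rightarrow> ('m, 2) chart set \<Rightarrow> ('m \<Rightarrow> 'n) \<Rightarrow>
    real set \<Rightarrow> real \<Rightarrow> (real \<Rightarrow> 'n) \<Rightarrow> ('m, 2) chart \<Rightarrow> bool" where
  "invariant_chart \<phi> AM f I \<epsilon> \<gamma> c \<longleftrightarrow> c \<in> AM \<and>
     snd c ` fst c = {z. z $ 1 \<in> I \<and> z $ 2 \<in> {-\<epsilon><..<\<epsilon>}} \<and>
     (\<forall>x\<in>fst c. f x = \<phi> (snd c x $ 2) (\<gamma> (snd c x $ 1)))"

text \<open>A curve \<open>\<alpha>\<close> on the immersed surface that makes the constant angle \<open>\<theta>\<close> with \<open>X\<close>.\<close>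

definition loxodrome :: "('n, 'd::finite) chart set \<Rightarrow> ('n, 'd) metric_tensor \<Rightarrow> ('n, 'd) vfield \<Rightarrow>
    'm topology \<Rightarrow> ('m, 2) chart set \<Rightarrow> ('m \<Rightarrow> 'n) \<Rightarrow> real set \<Rightarrow> (real \<Rightarrow> 'm) \<Rightarrow> real \<Rightarrow> bool" where
  "loxodrome A g X TM AM f J \<alpha> \<theta> \<longleftrightarrow> smooth_curve TM AM J \<alpha> \<and>
     (\<forall>s\<in>J. let p = f (\<alpha> s); w = differential AM A f (\<alpha> s) (velocity AM \<alpha> s)
            in g p w (X p) = tnorm g p w * tnorm g p (X p) * cos \<theta>)"

end

theory Submission
  imports Defs
begin

text \<open>In the coordinates \<open>(u, v)\<close> of \<open>\<psi>\<close> the induced metric is \<open>E du\<^sup>2 + 2 F du dv + \<omega>\<^sup>2 dv\<^sup>2\<close> with coefficients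
  that depend on \<open>u\<close> alone, because the flow of a Killing field acts by isometries. Along a unit speed
  geodesic the product with the Killing field \<open>\<partial>\<^sub>v = X\<close> is conserved (Clairaut); along a loxodrome it equals
  \<open>\<omega> cos \<vartheta>\<^sub>0\<close>, so \<open>\<omega>\<close> is constant on the curve. Since \<open>sin \<vartheta>\<^sub>0 \<noteq> 0\<close>, \<open>u\<close> has nonzero derivative along it, hence
  \<open>\<omega>\<close> is constant for all \<open>u\<close> in an open interval, and a metric of the above form with constant \<open>\<omega>\<close> has a
  closed orthonormal coframe. The flow carries this coframe to every point of the orbits.\<close>

section \<open>Calculus of smooth functions\<close>

text \<open>The conclusion concerns the part of the surface swept out by the curve under
  \<open>\<tau>\<close>, because a geodesic reveals \<open>\<omega>\<close> only at the values of
  \<open>u\<close> that it attains. The angle must differ from a right angle so that the cosine can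
  be cancelled in Clairaut's relation; at angle 0 the curve would run along an orbit, with
  \<open>u\<close> constant. Two definitions shape the argument. The curvature at a point is
  computed in a chart picked by choice, and the orbit of a point may leave the chart of
  \<open>\<psi>\<close>. Curvature is therefore never transformed between charts: the coframe is
  pulled back along a coordinate map \<open>Z\<close>, the representation of
  \<open>\<tau> (-t)\<close> from the picked chart into the chart of \<open>\<psi>\<close>, and the
  curvature is computed from the pulled back coframe. The Killing condition, in turn, is an
  infinitesimal equation for metric components, so the isometry property of the flow is derived by
  differentiating the flow equation in the initial point. The lift of the profile curve is not
  assumed horizontal, which is why a mixed coefficient \<open>F\<close> is carried along.\<close>

lemma differentiable_has_frechet:
  "f differentiable (at z) \<Longrightarrow> (f has_derivative frechet_derivative f (at z)) (at z)"
  by (simp add: frechet_derivative_works[symmetric])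

lemma frechet_derivative_eqI: "(f has_derivative f') (at z) \<Longrightarrow> frechet_derivative f (at z) = f'"
  by (rule frechet_derivative_at[symmetric])

text \<open>\<open>frechet_derivative\<close> is a choice among all derivatives, so it is enough
  that \<open>f\<close> and \<open>g\<close> have the same derivatives at \<open>z\<close>. The
  equation thus also holds where neither function is differentiable.\<close>

lemma frechet_derivative_cong_open:
  assumes "open S" "z \<in> S" "\<And>w. w \<in> S \<Longrightarrow> f w = g w"
  shows "frechet_derivative f (at z) = frechet_derivative g (at z)"
proof -
  have "\<And>D. (f has_derivative D) (at z) \<longleftrightarrow> (g has_derivative D) (at z)"
    using has_derivative_transform_within_open[OF _ assms(1,2)] assms(3) by metis
  then show ?thesis by (simp add: frechet_derivative_def)
qed

lemma Ck_on_SucD: "Ck_on (Suc k) S f \<Longrightarrow> Ck_on k S (\<lambda>z. frechet_derivative f (at z) a)"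
  by simp

lemma Ck_on_cong:
  assumes "open S" "\<And>z. z \<in> S \<Longrightarrow> f z = g z" "Ck_on k S f"
  shows "Ck_on k S g"
  using assms(2,3)
proof (induction k arbitrary: f g)
  case 0
  then show ?case by (simp cong: continuous_on_cong)
next
  case (Suc k)
  have eq: "frechet_derivative f (at z) = frechet_derivative g (at z)" if "z \<in> S" for z
    using frechet_derivative_cong_open[OF assms(1) that Suc.prems(1)] .
  have "g differentiable (at z)" if "z \<in> S" for z
  proof -
    have "(f has_derivative frechet_derivative f (at z)) (at z)"
      using Suc.prems that by (intro differentiable_has_frechet) simp
    then have "(g has_derivative frechet_derivative f (at z)) (at z)"
      by (rule has_derivative_transform_within_open[OF _ assms(1) that Suc.prems(1)])
    then show ?thesis by (auto simp: differentiable_def)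
  qed
  moreover have "Ck_on k S (\<lambda>z. frechet_derivative g (at z) a)" for a
    by (rule Suc.IH[OF _ Ck_on_SucD[OF Suc.prems(2), of a]]) (simp add: eq)
  ultimately show ?case by simp
qed

lemma Ck_on_subset: "Ck_on k S f \<Longrightarrow> T \<subseteq> S \<Longrightarrow> Ck_on k T f"
  by (induction k arbitrary: f) (auto intro: continuous_on_subset)

text \<open>Derivatives are taken at \<open>z\<close> in the full space and not within
  \<open>S\<close>, so each point can be judged on a neighbourhood of its own. This serves functions
  that are described by different charts near different points.\<close>

lemma Ck_on_local:
  assumes "\<And>z. z \<in> S \<Longrightarrow> \<exists>T. open T \<and> z \<in> T \<and> Ck_on k T f"
  shows "Ck_on k S f"
  using assms
proof (induction k arbitrary: f)
  case 0
  have "continuous (at z within S) f" if z: "z \<in> S" for z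
  proof -
    obtain T where "open T" "z \<in> T" "continuous_on T f"
      using 0[OF z] unfolding Ck_on.simps by blast
    then have "isCont f z" by (simp add: continuous_on_eq_continuous_at)
    then show ?thesis by (rule continuous_at_imp_continuous_at_within)
  qed
  then show ?case by (simp add: continuous_on_eq_continuous_within)
next
  case (Suc k)
  have "f differentiable (at z)" if "z \<in> S" for z using Suc.prems[OF that] by auto
  moreover have "Ck_on k S (\<lambda>z. frechet_derivative f (at z) a)" for a
  proof (rule Suc.IH)
    fix z assume "z \<in> S"
    then obtain T where "open T" "z \<in> T" "Ck_on (Suc k) T f" using Suc.prems by blast
    then show "\<exists>T. open T \<and> z \<in> T \<and> Ck_on k T (\<lambda>z. frechet_derivative f (at z) a)"
      by (intro exI[of _ T] conjI Ck_on_SucD)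
  qed
  ultimately show ?case by simp
qed

lemma Ck_on_Suc_imp: "Ck_on (Suc k) S f \<Longrightarrow> Ck_on k S f"
proof (induction k arbitrary: f)
  case 0
  then show ?case
    by (auto intro!: continuous_at_imp_continuous_on differentiable_imp_continuous_within)
next
  case (Suc k)
  have "Ck_on k S (\<lambda>z. frechet_derivative f (at z) a)" for a
    by (rule Suc.IH[OF Ck_on_SucD[OF Suc.prems]])
  then show ?case using Suc.prems by simp
qed

lemma smooth_on_imp_Ck: "smooth_on S f \<Longrightarrow> Ck_on k S f"
  by (simp add: smooth_on_def)

lemma smooth_on_differentiable: "smooth_on S f \<Longrightarrow> z \<in> S \<Longrightarrow> f differentiable (at z)"
  using smooth_on_imp_Ck[of S f 1] by simp

lemma smooth_on_frechet: "smooth_on S f \<Longrightarrow> smooth_on S (\<lambda>z. frechet_derivative f (at z) a)"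
  unfolding smooth_on_def using Ck_on_SucD by blast

section \<open>Closure of k times differentiable maps under sums, products and composition\<close>

lemma Ck_on_const: "Ck_on k S (\<lambda>_. c)"
  by (induction k arbitrary: c) simp_all

lemma Ck_on_bounded_linear:
  assumes "bounded_linear L" shows "Ck_on k S L"
proof (cases k)
  case 0
  then show ?thesis by (simp add: assms linear_continuous_on)
next
  case (Suc j)
  have d: "(L has_derivative L) (at z)" for z using assms by (simp add: bounded_linear_imp_has_derivative)
  show ?thesis unfolding Suc
    using d frechet_derivative_eqI[OF d] by (auto simp: differentiable_def Ck_on_const)
qed

lemma Ck_on_add:
  assumes "open S" "Ck_on k S f" "Ck_on k S g" shows "Ck_on k S (\<lambda>z. f z + g z)"
  using assms(2,3)
proof (induction k arbitrary: f g)
  case 0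
  then show ?case by (simp add: continuous_on_add)
next
  case (Suc k)
  have D: "((\<lambda>z. f z + g z) has_derivative
      (\<lambda>a. frechet_derivative f (at z) a + frechet_derivative g (at z) a)) (at z)" if "z \<in> S" for z
    using Suc.prems that by (intro has_derivative_add differentiable_has_frechet) auto
  have "Ck_on k S (\<lambda>z. frechet_derivative (\<lambda>z. f z + g z) (at z) a)" for a
    by (rule Ck_on_cong[OF assms(1) _ Suc.IH[OF Ck_on_SucD[OF Suc.prems(1), of a]
          Ck_on_SucD[OF Suc.prems(2), of a]]]) (simp add: frechet_derivative_eqI[OF D])
  then show ?case using D by (auto simp: differentiable_def)
qed

lemma Ck_on_sum:
  assumes "open S" "\<And>i. i \<in> I \<Longrightarrow> Ck_on k S (f i)" shows "Ck_on k S (\<lambda>z. \<Sum>i\<in>I. f i z)"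
  using assms(2)
  by (induction I rule: infinite_finite_induct) (auto simp: Ck_on_const intro: Ck_on_add[OF assms(1)])

text \<open>The Leibniz rule turns a derivative of \<open>B (f z) (g z)\<close> into two terms of
  the same shape, each with one factor differentiated; the undifferentiated factor is lowered by one
  order so that the induction hypothesis applies to both.\<close>

lemma Ck_on_bilinear:
  assumes "open S" "bounded_bilinear B" "Ck_on k S f" "Ck_on k S g"
  shows "Ck_on k S (\<lambda>z. B (f z) (g z))"
  using assms(3,4)
proof (induction k arbitrary: f g)
  case 0
  then show ?case by (simp add: bounded_bilinear.continuous_on[OF assms(2)])
next
  case (Suc k)
  have D: "((\<lambda>z. B (f z) (g z)) has_derivative
      (\<lambda>a. B (f z) (frechet_derivative g (at z) a) + B (frechet_derivative f (at z) a) (g z))) (at z)"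
    if "z \<in> S" for z
    using Suc.prems that
    by (intro bounded_bilinear.FDERIV[OF assms(2)] differentiable_has_frechet) auto
  have "Ck_on k S (\<lambda>z. frechet_derivative (\<lambda>z. B (f z) (g z)) (at z) a)" for a
  proof (rule Ck_on_cong[OF assms(1)])
    show "Ck_on k S (\<lambda>z. B (f z) (frechet_derivative g (at z) a) + B (frechet_derivative f (at z) a) (g z))"
      by (intro Ck_on_add[OF assms(1)] Suc.IH Ck_on_SucD[OF Suc.prems(1)] Ck_on_SucD[OF Suc.prems(2)]
          Ck_on_Suc_imp[OF Suc.prems(1)] Ck_on_Suc_imp[OF Suc.prems(2)])
  qed (simp add: frechet_derivative_eqI[OF D])
  then show ?case using D by (auto simp: differentiable_def)
qed

lemma Ck_on_mult: "open S \<Longrightarrow> Ck_on k S f \<Longrightarrow> Ck_on k S g \<Longrightarrow> Ck_on k S (\<lambda>z. f z * g z :: real)"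
  by (rule Ck_on_bilinear[OF _ bounded_bilinear_mult])

lemma Ck_on_scaleR: "open S \<Longrightarrow> Ck_on k S f \<Longrightarrow> Ck_on k S g \<Longrightarrow> Ck_on k S (\<lambda>z. f z *\<^sub>R g z)"
  by (rule Ck_on_bilinear[OF _ bounded_bilinear_scaleR])

lemma Ck_on_linear_comp:
  assumes "open S" "bounded_linear L" "Ck_on k S f" shows "Ck_on k S (\<lambda>z. L (f z))"
  using assms(3)
proof (induction k arbitrary: f)
  case 0
  then show ?case by (simp add: bounded_linear.continuous_on[OF assms(2)])
next
  case (Suc k)
  have D: "((\<lambda>z. L (f z)) has_derivative (\<lambda>a. L (frechet_derivative f (at z) a))) (at z)"
    if "z \<in> S" for z
    using Suc.prems that
    by (intro bounded_linear.has_derivative[OF assms(2)] differentiable_has_frechet) auto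
  have "Ck_on k S (\<lambda>z. frechet_derivative (\<lambda>z. L (f z)) (at z) a)" for a
    by (rule Ck_on_cong[OF assms(1) _ Suc.IH[OF Ck_on_SucD[OF Suc.prems, of a]]])
      (simp add: frechet_derivative_eqI[OF D])
  then show ?case using D by (auto simp: differentiable_def)
qed

lemma Ck_on_nth: "open S \<Longrightarrow> Ck_on k S f \<Longrightarrow> Ck_on k S (\<lambda>z. f z $ i)"
  by (rule Ck_on_linear_comp[OF _ bounded_linear_vec_nth])

lemma Ck_on_compose:
  fixes g :: "'a::euclidean_space \<Rightarrow> 'b::euclidean_space"
  assumes S: "open S" and T: "open T" and "\<And>z. z \<in> S \<Longrightarrow> g z \<in> T" "Ck_on k S g" "Ck_on k T f"
  shows "Ck_on k S (\<lambda>z. f (g z))"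
  using assms(3-5)
proof (induction k arbitrary: f)
  case 0
  then show ?case by (auto intro: continuous_on_compose2)
next
  case (Suc k)
  have D: "((\<lambda>z. f (g z)) has_derivative
      (\<lambda>a. frechet_derivative f (at (g z)) (frechet_derivative g (at z) a))) (at z)" if "z \<in> S" for z
    using Suc.prems that
    by (intro has_derivative_compose[of g _ z UNIV f] differentiable_has_frechet) auto
  \<comment> \<open>In the chain rule the direction in which \<open>f\<close> is differentiated
    depends on \<open>z\<close>, whereas \<open>Ck_on\<close> speaks of fixed directions. Expanding
    in the basis leaves fixed directions with variable coefficients.\<close>
  have exp: "frechet_derivative f (at (g z)) w = (\<Sum>b\<in>Basis. (w \<bullet> b) *\<^sub>R frechet_derivative f (at (g z)) b)"
    if "z \<in> S" for z w
  proof -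
    have l: "linear (frechet_derivative f (at (g z)))"
      using Suc.prems that by (intro linear_frechet_derivative) auto
    have "frechet_derivative f (at (g z)) w = frechet_derivative f (at (g z)) (\<Sum>b\<in>Basis. (w \<bullet> b) *\<^sub>R b)"
      by (simp add: euclidean_representation)
    also have "\<dots> = (\<Sum>b\<in>Basis. (w \<bullet> b) *\<^sub>R frechet_derivative f (at (g z)) b)"
      by (simp only: linear_sum[OF l] linear_scale[OF l])
    finally show ?thesis .
  qed
  have "Ck_on k S (\<lambda>z. frechet_derivative (\<lambda>z. f (g z)) (at z) a)" for a
  proof (rule Ck_on_cong[OF S])
    show "Ck_on k S (\<lambda>z. \<Sum>b\<in>Basis. (frechet_derivative g (at z) a \<bullet> b) *\<^sub>R frechet_derivative f (at (g z)) b)"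
      by (intro Ck_on_sum[OF S] Ck_on_scaleR[OF S] Ck_on_linear_comp[OF S bounded_linear_inner_left]
          Ck_on_SucD[OF Suc.prems(2)] Suc.IH Suc.prems(1) Ck_on_SucD[OF Suc.prems(3)]
          Ck_on_Suc_imp[OF Suc.prems(2)])
  next
    fix z assume z: "z \<in> S"
    show "(\<Sum>b\<in>Basis. (frechet_derivative g (at z) a \<bullet> b) *\<^sub>R frechet_derivative f (at (g z)) b) =
        frechet_derivative (\<lambda>z. f (g z)) (at z) a"
      by (simp add: frechet_derivative_eqI[OF D[OF z]] exp[OF z, symmetric])
  qed
  then show ?case using D by (auto simp: differentiable_def)
qed

lemma smooth_on_compose:
  fixes g :: "'a::euclidean_space \<Rightarrow> 'b::euclidean_space"
  assumes "open S" "open T" "\<And>z. z \<in> S \<Longrightarrow> g z \<in> T" "smooth_on S g" "smooth_on T f"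
  shows "smooth_on S (\<lambda>z. f (g z))"
  using assms Ck_on_compose unfolding smooth_on_def by blast

lemma smooth_on_local:
  assumes "\<And>z. z \<in> S \<Longrightarrow> \<exists>T. open T \<and> z \<in> T \<and> smooth_on T f"
  shows "smooth_on S f"
  using assms Ck_on_local unfolding smooth_on_def by metis

lemma smooth_on_cong:
  assumes "open S" "\<And>z. z \<in> S \<Longrightarrow> f z = g z" "smooth_on S f"
  shows "smooth_on S g"
  using assms Ck_on_cong unfolding smooth_on_def by metis

lemma smooth_on_subset: "smooth_on S f \<Longrightarrow> T \<subseteq> S \<Longrightarrow> smooth_on T f"
  unfolding smooth_on_def using Ck_on_subset by blast

lemma has_derivative_powr_const:
  assumes "(x::real) > 0"
  shows "((\<lambda>x. x powr r) has_derivative (\<lambda>a. a * (r * x powr (r - 1)))) (at x)"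
  using has_real_derivative_powr[OF assms, of r] unfolding has_field_derivative_def
  by (rule has_derivative_eq_rhs) (simp add: fun_eq_iff)

text \<open>The exponent is arbitrary in the induction because differentiation lowers it. The
  exponent 1/2 gives the square root in the coframe.\<close>

lemma Ck_on_powr: "Ck_on k {0<..} (\<lambda>x::real. x powr r)"
proof (induction k arbitrary: r)
  case 0
  then show ?case by (auto intro!: continuous_intros)
next
  case (Suc k)
  have "Ck_on k {0<..} (\<lambda>z. frechet_derivative (\<lambda>x. x powr r) (at z) a)" for a :: real
  proof (rule Ck_on_cong)
    show "Ck_on k {0<..} (\<lambda>x. a * (r * x powr (r - 1)))"
      by (intro Ck_on_mult open_greaterThan Ck_on_const Suc.IH)
  qed (auto simp: frechet_derivative_eqI[OF has_derivative_powr_const])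
  then show ?case using has_derivative_powr_const by (auto simp: differentiable_def)
qed

section \<open>Symmetry of second derivatives\<close>

lemma has_derivative_line:
  assumes "f differentiable (at (z + x *\<^sub>R a))"
  shows "((\<lambda>x. f (z + x *\<^sub>R a)) has_vector_derivative frechet_derivative f (at (z + x *\<^sub>R a)) a) (at x)"
proof -
  have "((\<lambda>x. z + x *\<^sub>R a) has_derivative (\<lambda>y. y *\<^sub>R a)) (at x)"
    by (auto intro!: derivative_eq_intros)
  then have "((\<lambda>x. f (z + x *\<^sub>R a)) has_derivative (\<lambda>y. frechet_derivative f (at (z + x *\<^sub>R a)) (y *\<^sub>R a))) (at x)"
    by (rule has_derivative_compose[where g = f]) (rule differentiable_has_frechet[OF assms])
  then show ?thesis
    by (simp add: has_vector_derivative_def linear_scale[OF linear_frechet_derivative[OF assms]])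
qed

text \<open>Both mixed derivatives are limits of the second difference quotient, by two applications of the
  mean value theorem.\<close>

lemma second_difference:
  fixes f :: "'a::euclidean_space \<Rightarrow> real"
  assumes C: "Ck_on (Suc (Suc 0)) S f" and t: "t > 0"
    and sub: "\<And>x y. 0 \<le> x \<Longrightarrow> x \<le> t \<Longrightarrow> 0 \<le> y \<Longrightarrow> y \<le> t \<Longrightarrow> z + x *\<^sub>R a + y *\<^sub>R b \<in> S"
  shows "\<exists>x y. 0 < x \<and> x < t \<and> 0 < y \<and> y < t \<and>
    f (z + t *\<^sub>R a + t *\<^sub>R b) - f (z + t *\<^sub>R a) - f (z + t *\<^sub>R b) + f z =
    t * t * frechet_derivative (\<lambda>w. frechet_derivative f (at w) a) (at (z + x *\<^sub>R a + y *\<^sub>R b)) b"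
proof -
  let ?D = "\<lambda>w. frechet_derivative f (at w) a"
  have df: "f differentiable (at w)" if "w \<in> S" for w using C that by simp
  have dD: "?D differentiable (at w)" if "w \<in> S" for w using C that by simp
  \<comment> \<open>The second difference is the increment of \<open>?g\<close> from 0 to
    \<open>t\<close>: the difference in direction \<open>b\<close>, as a function of the
    displacement along \<open>a\<close>.\<close>
  let ?g = "\<lambda>x. f (z + t *\<^sub>R b + x *\<^sub>R a) - f (z + x *\<^sub>R a)"
  have g: "(?g has_real_derivative (?D (z + t *\<^sub>R b + x *\<^sub>R a) - ?D (z + x *\<^sub>R a))) (at x)"
    if "0 \<le> x" "x \<le> t" for x
  proof -
    have "z + t *\<^sub>R b + x *\<^sub>R a \<in> S" "z + x *\<^sub>R a \<in> S"
      using sub[of x t] sub[of x 0] that t by (simp_all add: algebra_simps)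
    then show ?thesis
      using has_vector_derivative_diff[OF has_derivative_line[OF df] has_derivative_line[OF df]]
      by (simp add: has_real_derivative_iff_has_vector_derivative)
  qed
  obtain x where x: "0 < x" "x < t"
    "?g t - ?g 0 = (t - 0) * (?D (z + t *\<^sub>R b + x *\<^sub>R a) - ?D (z + x *\<^sub>R a))"
    using MVT2[OF t g] by blast
  let ?h = "\<lambda>y. ?D (z + x *\<^sub>R a + y *\<^sub>R b)"
  have h: "(?h has_real_derivative frechet_derivative ?D (at (z + x *\<^sub>R a + y *\<^sub>R b)) b) (at y)"
    if "0 \<le> y" "y \<le> t" for y
    using has_derivative_line[OF dD[OF sub[of x y]]] x that
    by (simp add: has_real_derivative_iff_has_vector_derivative)
  obtain y where y: "0 < y" "y < t"
    "?h t - ?h 0 = (t - 0) * frechet_derivative ?D (at (z + x *\<^sub>R a + y *\<^sub>R b)) b"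
    using MVT2[OF t h] by blast
  show ?thesis
    using x y by (intro exI[of _ x] exI[of _ y]) (simp add: algebra_simps)
qed

lemma second_derivative_symmetric_real:
  fixes f :: "'a::euclidean_space \<Rightarrow> real"
  assumes C: "Ck_on (Suc (Suc 0)) S f" and S: "open S" "z \<in> S"
  shows "frechet_derivative (\<lambda>w. frechet_derivative f (at w) a) (at z) b =
         frechet_derivative (\<lambda>w. frechet_derivative f (at w) b) (at z) a" (is "?A z = ?B z")
proof (rule ccontr)
  assume ne: "?A z \<noteq> ?B z"
  \<comment> \<open>Half of the gap: one and the same number cannot lie within \<open>e\<close> of
    both \<open>?A z\<close> and \<open>?B z\<close>.\<close>
  define e where "e = \<bar>?A z - ?B z\<bar> / 2"
  have e: "e > 0" using ne by (simp add: e_def)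
  have cA: "continuous_on S ?A" and cB: "continuous_on S ?B" using C by simp_all
  have "\<forall>\<^sub>F w in nhds z. \<bar>?A w - ?A z\<bar> < e \<and> \<bar>?B w - ?B z\<bar> < e \<and> w \<in> S"
  proof (intro eventually_conj)
    have tends: "\<forall>\<^sub>F w in nhds z. \<bar>h w - h z\<bar> < e" if "continuous_on S h" for h :: "'a \<Rightarrow> real"
    proof -
      have "isCont h z" using that S by (simp add: continuous_on_eq_continuous_at)
      then have "(h \<longlongrightarrow> h z) (nhds z)" by (simp add: isCont_def tendsto_nhds_iff)
      then show ?thesis using e by (auto simp: tendsto_iff dist_real_def)
    qed
    show "\<forall>\<^sub>F w in nhds z. \<bar>?A w - ?A z\<bar> < e" "\<forall>\<^sub>F w in nhds z. \<bar>?B w - ?B z\<bar> < e"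
      using tends[OF cA] tends[OF cB] by auto
    show "\<forall>\<^sub>F w in nhds z. w \<in> S" using S by (rule eventually_nhds_in_open)
  qed
  then obtain d where d: "d > 0"
    "\<And>w. dist w z < d \<Longrightarrow> \<bar>?A w - ?A z\<bar> < e \<and> \<bar>?B w - ?B z\<bar> < e \<and> w \<in> S"
    by (auto simp: eventually_nhds_metric)
  \<comment> \<open>The parallelogram with sides \<open>t\<close> times \<open>a\<close> and
    \<open>t\<close> times \<open>b\<close> then stays within \<open>d / 2\<close> of
    \<open>z\<close>; the summand 1 covers the case that both vectors vanish.\<close>
  define t where "t = d / (2 * (norm a + norm b + 1))"
  have n: "norm a + norm b + 1 > 0" by (smt (verit) norm_ge_zero)
  have t: "t > 0" using d(1) n by (simp add: t_def)
  have near: "dist (z + x *\<^sub>R a + y *\<^sub>R b) z < d" if "0 \<le> x" "x \<le> t" "0 \<le> y" "y \<le> t" for x y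
  proof -
    have "dist (z + x *\<^sub>R a + y *\<^sub>R b) z \<le> x * norm a + y * norm b"
      using norm_triangle_ineq[of "x *\<^sub>R a" "y *\<^sub>R b"] that by (simp add: dist_norm add.assoc)
    also have "\<dots> \<le> t * norm a + t * norm b"
      by (intro add_mono mult_right_mono that) simp_all
    also have "\<dots> \<le> t * (norm a + norm b + 1)" using t by (simp add: algebra_simps)
    also have "\<dots> = d / 2" using n by (simp add: t_def field_simps)
    finally show ?thesis using d(1) by simp
  qed
  obtain x y where xy: "0 < x" "x < t" "0 < y" "y < t"
    "f (z + t *\<^sub>R a + t *\<^sub>R b) - f (z + t *\<^sub>R a) - f (z + t *\<^sub>R b) + f z = t * t * ?A (z + x *\<^sub>R a + y *\<^sub>R b)"
    using second_difference[OF C t, of z a b] d(2) near by blast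
  have near': "z + x *\<^sub>R b + y *\<^sub>R a \<in> S" if "0 \<le> x" "x \<le> t" "0 \<le> y" "y \<le> t" for x y
    using d(2)[OF near[of y x]] that by (simp add: algebra_simps)
  obtain x' y' where xy': "0 < x'" "x' < t" "0 < y'" "y' < t"
    "f (z + t *\<^sub>R b + t *\<^sub>R a) - f (z + t *\<^sub>R b) - f (z + t *\<^sub>R a) + f z = t * t * ?B (z + x' *\<^sub>R b + y' *\<^sub>R a)"
    using second_difference[OF C t, of z b a] near' by blast
  \<comment> \<open>The second difference is symmetric in \<open>a\<close> and \<open>b\<close>, so
    the two mean value expressions for it agree.\<close>
  have "t * t * ?A (z + x *\<^sub>R a + y *\<^sub>R b) = t * t * ?B (z + x' *\<^sub>R b + y' *\<^sub>R a)"
    using xy(5) xy'(5) by (simp add: algebra_simps)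
  then have "?A (z + x *\<^sub>R a + y *\<^sub>R b) = ?B (z + y' *\<^sub>R a + x' *\<^sub>R b)"
    using t by (simp add: algebra_simps)
  moreover have "\<bar>?A (z + x *\<^sub>R a + y *\<^sub>R b) - ?A z\<bar> < e" "\<bar>?B (z + y' *\<^sub>R a + x' *\<^sub>R b) - ?B z\<bar> < e"
    using d(2)[OF near[of x y]] d(2)[OF near[of y' x']] xy xy' by auto
  ultimately have "\<bar>?A z - ?B z\<bar> < e + e" by (simp add: abs_less_iff)
  then show False by (simp add: e_def)
qed

lemma frechet_linear_comp:
  assumes "bounded_linear L" "f differentiable (at z)"
  shows "frechet_derivative (\<lambda>w. L (f w)) (at z) = (\<lambda>a. L (frechet_derivative f (at z) a))"
  by (intro frechet_derivative_eqI bounded_linear.has_derivative[OF assms(1)] differentiable_has_frechet assms(2))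

lemma second_derivative_symmetric:
  fixes f :: "'a::euclidean_space \<Rightarrow> 'b::euclidean_space"
  assumes C: "Ck_on (Suc (Suc 0)) S f" and S: "open S" "z \<in> S"
  shows "frechet_derivative (\<lambda>w. frechet_derivative f (at w) a) (at z) b =
         frechet_derivative (\<lambda>w. frechet_derivative f (at w) b) (at z) a"
proof (rule euclidean_eqI)
  fix i :: 'b
  have bl: "bounded_linear (\<lambda>y. y \<bullet> i)" by (rule bounded_linear_inner_left)
  have 1: "frechet_derivative (\<lambda>w. frechet_derivative (\<lambda>w. f w \<bullet> i) (at w) a) (at z) b =
      frechet_derivative (\<lambda>w. frechet_derivative f (at w) a) (at z) b \<bullet> i" for a b
  proof -
    have "frechet_derivative (\<lambda>w. frechet_derivative (\<lambda>w. f w \<bullet> i) (at w) a) (at z) =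
        frechet_derivative (\<lambda>w. frechet_derivative f (at w) a \<bullet> i) (at z)"
      by (rule frechet_derivative_cong_open[OF S]) (use C in \<open>simp add: frechet_linear_comp[OF bl]\<close>)
    also have "\<dots> = (\<lambda>b. frechet_derivative (\<lambda>w. frechet_derivative f (at w) a) (at z) b \<bullet> i)"
      by (rule frechet_linear_comp[OF bl]) (use C S in simp)
    finally show ?thesis by simp
  qed
  have "Ck_on (Suc (Suc 0)) S (\<lambda>w. f w \<bullet> i)" by (rule Ck_on_linear_comp[OF S(1) bl C])
  from second_derivative_symmetric_real[OF this S, of a b]
  show "frechet_derivative (\<lambda>w. frechet_derivative f (at w) a) (at z) b \<bullet> i =
         frechet_derivative (\<lambda>w. frechet_derivative f (at w) b) (at z) a \<bullet> i" by (simp only: 1)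
qed

section \<open>Curvature of a closed coframe\<close>

text \<open>\<open>matrix_inv\<close> is a choice among the two-sided inverses, and a nonzero
  determinant guarantees that there is one to choose.\<close>

lemma matrix_inv_right:
  fixes H :: "real^'n^'n"
  assumes "det H \<noteq> 0" shows "H ** matrix_inv H = mat 1"
  using assms someI_ex[of "\<lambda>B. H ** B = mat 1 \<and> B ** H = mat 1"]
  unfolding invertible_det_nz[symmetric] invertible_def matrix_inv_def by blast

text \<open>\<open>P i\<close> lists the values of two one-forms on the i-th coordinate vector, so
  \<open>h\<close> is its Gram matrix and \<open>closed\<close> says that the forms are closed. In
  the derivatives of \<open>h\<close> that make up a Christoffel symbol, closedness cancels
  everything except twice the product of \<open>Q i j\<close> with \<open>P l\<close>. The symbols
  are therefore the coordinates of \<open>Q i j\<close> in the frame \<open>P\<close>.\<close>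

lemma christoffel_coframe:
  fixes P :: "2 \<Rightarrow> real^2 \<Rightarrow> real^2"
  assumes S: "open S" "w \<in> S"
    and h: "\<And>w i j. w \<in> S \<Longrightarrow> h w $ i $ j = P i w \<bullet> P j w"
    and diff: "\<And>i. P i differentiable (at w)"
    and closed: "\<And>i j. frechet_derivative (P i) (at w) (axis j 1) = frechet_derivative (P j) (at w) (axis i 1)"
    and det: "det (h w) \<noteq> 0"
  shows "(\<Sum>k\<in>UNIV. christoffel h w k i j *\<^sub>R P k w) = frechet_derivative (P j) (at w) (axis i 1)"
proof -
  define Q where "Q i j = frechet_derivative (P j) (at w) (axis i 1)" for i j
  have Qsym: "Q i j = Q j i" for i j using closed by (simp add: Q_def)
  have ph: "partial i (\<lambda>w. h w $ j $ l) w = Q i j \<bullet> P l w + P j w \<bullet> Q i l" for i j l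
  proof -
    have "frechet_derivative (\<lambda>w. h w $ j $ l) (at w) = frechet_derivative (\<lambda>w. P j w \<bullet> P l w) (at w)"
      by (rule frechet_derivative_cong_open[OF S h])
    also have "\<dots> = (\<lambda>a. P j w \<bullet> frechet_derivative (P l) (at w) a + frechet_derivative (P j) (at w) a \<bullet> P l w)"
      by (intro frechet_derivative_eqI has_derivative_inner differentiable_has_frechet diff)
    finally show ?thesis by (simp add: partial_def Q_def)
  qed
  have chr: "christoffel h w k i j = (\<Sum>l\<in>UNIV. matrix_inv (h w) $ k $ l * (Q i j \<bullet> P l w))" for k
  proof -
    have "partial i (\<lambda>w. h w $ j $ l) w + partial j (\<lambda>w. h w $ i $ l) w - partial l (\<lambda>w. h w $ i $ j) w
        = 2 * (Q i j \<bullet> P l w)" for l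
      unfolding ph by (simp add: Qsym[of j i] Qsym[of l i] Qsym[of l j] inner_commute)
    then show ?thesis by (simp add: christoffel_def sum_distrib_left)
  qed
  have inv: "h w ** matrix_inv (h w) = mat 1"
    using det by (rule matrix_inv_right)
  \<comment> \<open>The defect of the claimed identity. It is orthogonal to both vectors
    \<open>P l\<close>, and these are independent: with them as rows of \<open>A\<close>,
    \<open>h w\<close> is \<open>A\<close> times its transpose and has nonzero determinant.\<close>
  define v where "v = (\<Sum>k\<in>UNIV. christoffel h w k i j *\<^sub>R P k w) - Q i j"
  have "v \<bullet> P l w = 0" for l
  proof -
    have "(\<Sum>k\<in>UNIV. christoffel h w k i j *\<^sub>R P k w) \<bullet> P l w
        = (\<Sum>k\<in>UNIV. \<Sum>m\<in>UNIV. matrix_inv (h w) $ k $ m * (Q i j \<bullet> P m w) * h w $ l $ k)"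
      by (simp add: inner_sum_left chr sum_distrib_right h[OF S(2)] inner_commute[of "P l w" "P k w" for k])
    also have "\<dots> = (\<Sum>m\<in>UNIV. (Q i j \<bullet> P m w) * (\<Sum>k\<in>UNIV. h w $ l $ k * matrix_inv (h w) $ k $ m))"
      by (subst sum.swap) (simp add: sum_distrib_left mult_ac)
    also have "\<dots> = (\<Sum>m\<in>UNIV. (Q i j \<bullet> P m w) * (mat 1 :: real^2^2) $ l $ m)"
      by (simp add: inv[symmetric] matrix_matrix_mult_def)
    also have "\<dots> = Q i j \<bullet> P l w" by (simp add: mat_def if_distrib cong: if_cong)
    finally show ?thesis by (simp add: v_def inner_diff_left)
  qed
  moreover define A where "A = (\<chi> l. P l w)"
  ultimately have Av: "A *v v = 0"
    by (simp add: vec_eq_iff matrix_vector_mult_def inner_vec_def mult.commute)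
  have "h w = A ** transpose A"
    by (simp add: vec_eq_iff A_def matrix_matrix_mult_def transpose_def h[OF S(2)] inner_vec_def)
  then have "det A \<noteq> 0" using det by (auto simp: det_mul)
  then have "v = 0" using Av by (metis invertible_det_nz invertible_left_inverse matrix_left_invertible_ker)
  then show ?thesis by (simp add: v_def Q_def)
qed

text \<open>The Christoffel symbols are the connection coefficients of the trivial connection in the frame
  \<open>P\<close>, so that the curvature vanishes because second derivatives of \<open>P\<close> commute.\<close>

lemma gauss_curvature_coframe_zero:
  fixes P :: "2 \<Rightarrow> real^2 \<Rightarrow> real^2"
  assumes S: "open S" "z \<in> S"
    and h: "\<And>w i j. w \<in> S \<Longrightarrow> h w $ i $ j = P i w \<bullet> P j w"
    and C: "\<And>i. Ck_on (Suc (Suc 0)) S (P i)"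
    and closed: "\<And>w i j. w \<in> S \<Longrightarrow>
      frechet_derivative (P i) (at w) (axis j 1) = frechet_derivative (P j) (at w) (axis i 1)"
    and det: "\<And>w. w \<in> S \<Longrightarrow> det (h w) \<noteq> 0"
  shows "gauss_curvature_coord h z = 0"
proof -
  define Q where "Q i j w = frechet_derivative (P j) (at w) (axis i 1)" for i j w
  have dP: "P i differentiable (at w)" if "w \<in> S" for i w using C that by simp
  have dQ: "Q i j differentiable (at w)" if "w \<in> S" for i j w using C that by (simp add: Q_def[abs_def])
  have frame: "(\<Sum>k\<in>UNIV. christoffel h w k i j *\<^sub>R P k w) = Q i j w" if "w \<in> S" for i j w
    unfolding Q_def by (rule christoffel_coframe[OF S(1) that h dP[OF that] closed[OF that] det[OF that]])
  define \<delta> where "\<delta> w = P 1 w $ 1 * P 2 w $ 2 - P 1 w $ 2 * P 2 w $ 1" for w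
  have \<delta>: "\<delta> w \<noteq> 0" if "w \<in> S" for w
  proof -
    have "det (h w) = \<delta> w * \<delta> w"
      by (simp add: det_2 h[OF that] inner_vec_def sum_2 \<delta>_def algebra_simps)
    then show ?thesis using det[OF that] by auto
  qed
  \<comment> \<open>Solving the frame equation by Cramer's rule presents the Christoffel symbols as
    quotients of differentiable functions, which their definition through \<open>matrix_inv\<close>
    does not show directly.\<close>
  have cramer: "christoffel h w 1 i j = (Q i j w $ 1 * P 2 w $ 2 - Q i j w $ 2 * P 2 w $ 1) / \<delta> w"
    "christoffel h w 2 i j = (P 1 w $ 1 * Q i j w $ 2 - P 1 w $ 2 * Q i j w $ 1) / \<delta> w"
    if "w \<in> S" for w i j
    using \<delta>[OF that] unfolding frame[OF that, symmetric]
    by (simp_all add: sum_2 field_simps \<delta>_def)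
  have dnth: "(\<lambda>w. f w $ i) differentiable (at w)"
    if "f differentiable (at w)" for f :: "real^2 \<Rightarrow> real^2" and i w
    using that by (auto simp: differentiable_def intro: bounded_linear.has_derivative[OF bounded_linear_vec_nth])
  have dchr: "(\<lambda>w. christoffel h w k i j) differentiable (at z)" for k i j
  proof -
    have "(\<lambda>w. (Q i j w $ 1 * P 2 w $ 2 - Q i j w $ 2 * P 2 w $ 1) / \<delta> w) differentiable (at z)"
      "(\<lambda>w. (P 1 w $ 1 * Q i j w $ 2 - P 1 w $ 2 * Q i j w $ 1) / \<delta> w) differentiable (at z)"
      unfolding \<delta>_def
      by (intro differentiable_divide differentiable_diff differentiable_mult dnth dP dQ S
          \<delta>[OF S(2), unfolded \<delta>_def])+
    then have "(\<lambda>w. christoffel h w 1 i j) differentiable (at z)" "(\<lambda>w. christoffel h w 2 i j) differentiable (at z)"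
      unfolding differentiable_def
      by (metis (no_types, lifting) has_derivative_transform_within_open[OF _ S] cramer)+
    then show ?thesis using exhaust_2[of k] by auto
  qed
  have diffframe: "frechet_derivative (Q i j) (at z) (axis m 1) =
      (\<Sum>k\<in>UNIV. partial m (\<lambda>w. christoffel h w k i j) z *\<^sub>R P k z + christoffel h z k i j *\<^sub>R Q m k z)" for i j m
  proof -
    have "frechet_derivative (Q i j) (at z) = frechet_derivative (\<lambda>w. \<Sum>k\<in>UNIV. christoffel h w k i j *\<^sub>R P k w) (at z)"
      by (rule frechet_derivative_cong_open[OF S]) (simp add: frame)
    also have "\<dots> = (\<lambda>a. \<Sum>k\<in>UNIV. christoffel h z k i j *\<^sub>R frechet_derivative (P k) (at z) a
        + frechet_derivative (\<lambda>w. christoffel h w k i j) (at z) a *\<^sub>R P k z)"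
      by (intro frechet_derivative_eqI has_derivative_sum has_derivative_scaleR differentiable_has_frechet dP dchr S)
    finally show ?thesis by (simp add: partial_def Q_def add.commute)
  qed
  have "frechet_derivative (Q 2 2) (at z) (axis 1 1) = frechet_derivative (Q 1 2) (at z) (axis 2 1)"
    unfolding Q_def by (rule second_derivative_symmetric[OF C S])
  \<comment> \<open>Differentiating the frame equation produces the derivative terms of the
    curvature, and replacing the remaining \<open>Q m k\<close> by the frame equation produces the
    quadratic ones.\<close>
  moreover have "(\<Sum>l\<in>UNIV. riemann h z l 2 1 2 *\<^sub>R P l z) =
      frechet_derivative (Q 2 2) (at z) (axis 1 1) - frechet_derivative (Q 1 2) (at z) (axis 2 1)"
    unfolding diffframe frame[OF S(2), symmetric]
    by (simp add: riemann_def sum_2 scaleR_add_left scaleR_diff_left algebra_simps)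
  ultimately have "(\<Sum>l\<in>UNIV. riemann h z l 2 1 2 *\<^sub>R P l z) = 0" by simp
  \<comment> \<open>The inner product with \<open>P 1\<close> lowers the upper index and gives the
    numerator of the Gauss curvature.\<close>
  then have "P 1 z \<bullet> (\<Sum>l\<in>UNIV. riemann h z l 2 1 2 *\<^sub>R P l z) = 0" by simp
  then show ?thesis
    by (simp add: gauss_curvature_coord_def h[OF S(2)] inner_sum_right mult.commute)
qed

section \<open>Manifolds in local coordinates\<close>

lemma chart_subset_topspace: "is_chart T c \<Longrightarrow> fst c \<subseteq> topspace T"
  by (simp add: is_chart_def openin_subset)

lemma chart_inj_on: "is_chart T c \<Longrightarrow> inj_on (snd c) (fst c)"
  using homeomorphic_imp_injective_map[of "subtopology T (fst c)"] chart_subset_topspace[of T c]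
  by (auto simp: is_chart_def topspace_subtopology inf_absorb2)

lemma chart_inverse: "is_chart T c \<Longrightarrow> p \<in> fst c \<Longrightarrow> inv_into (fst c) (snd c) (snd c p) = p"
  by (simp add: chart_inj_on)

lemma open_chart_image:
  assumes c: "is_chart T c" and U: "openin T U"
  shows "open (snd c ` (fst c \<inter> U))"
proof -
  have "open_map (subtopology T (fst c)) (top_of_set (snd c ` fst c)) (snd c)"
    using c by (simp add: is_chart_def homeomorphic_imp_open_map)
  moreover have "openin (subtopology T (fst c)) (fst c \<inter> U)"
    using U by (simp add: openin_subtopology_Int2)
  ultimately have "openin (top_of_set (snd c ` fst c)) (snd c ` (fst c \<inter> U))"
    by (simp add: open_map_def)
  then show ?thesis using c by (simp add: is_chart_def openin_open_eq)
qed

lemma chart_inverse_continuous: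
  assumes c: "is_chart T c"
  shows "continuous_map (top_of_set (snd c ` fst c)) T (inv_into (fst c) (snd c))"
  unfolding continuous_map_def
proof (intro conjI allI impI)
  show "inv_into (fst c) (snd c) \<in> topspace (top_of_set (snd c ` fst c)) \<rightarrow> topspace T"
    using chart_subset_topspace[OF c] chart_inverse[OF c] by auto
  fix U assume U: "openin T U"
  have "{z \<in> snd c ` fst c. inv_into (fst c) (snd c) z \<in> U} = snd c ` (fst c \<inter> U)"
    using chart_inverse[OF c] by auto
  then show "openin (top_of_set (snd c ` fst c))
      {z \<in> topspace (top_of_set (snd c ` fst c)). inv_into (fst c) (snd c) z \<in> U}"
    using open_chart_image[OF c U] c by (simp add: is_chart_def openin_open_eq image_mono)
qed

lemma smooth_manifold_chart: "smooth_manifold T A \<Longrightarrow> c \<in> A \<Longrightarrow> is_chart T c"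
  by (simp add: smooth_manifold_def)

lemma chart_at_props:
  assumes "smooth_manifold T A" "p \<in> topspace T"
  shows "chart_at A p \<in> A" "p \<in> fst (chart_at A p)"
proof -
  have "(\<Union>c\<in>A. fst c) = topspace T" using assms(1) unfolding smooth_manifold_def by (elim conjE)
  then have "\<exists>c. c \<in> A \<and> p \<in> fst c" using assms(2) by blast
  then have "chart_at A p \<in> A \<and> p \<in> fst (chart_at A p)" unfolding chart_at_def by (rule someI_ex)
  then show "chart_at A p \<in> A" "p \<in> fst (chart_at A p)" by auto
qed

text \<open>Transition maps are the case \<open>f = id\<close>, so changes of charts and smooth maps
  are governed by one chain rule.\<close>

definition local_rep :: "('p \<Rightarrow> 'q) \<Rightarrow> ('p, 'd::finite) chart \<Rightarrow> ('q, 'e::finite) chart \<Rightarrow> real^'d \<Rightarrow> real^'e"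
  where "local_rep f c e = snd e \<circ> f \<circ> inv_into (fst c) (snd c)"

definition manifold_map :: "'p topology \<Rightarrow> ('p, 'd::finite) chart set \<Rightarrow>
    'q topology \<Rightarrow> ('q, 'e::finite) chart set \<Rightarrow> ('p \<Rightarrow> 'q) \<Rightarrow> bool" where
  "manifold_map T A T' A' f \<longleftrightarrow>
     smooth_manifold T A \<and> smooth_manifold T' A' \<and> smooth_map_on T A (topspace T) T' A' f"

definition rep_domain :: "('p \<Rightarrow> 'q) \<Rightarrow> ('p, 'd::finite) chart \<Rightarrow> ('q, 'e::finite) chart \<Rightarrow> (real^'d) set"
  where "rep_domain f c e = snd c ` {p \<in> fst c. f p \<in> fst e}"

lemma transition_eq_local_rep: "transition c e = local_rep id c e"
  by (simp add: transition_def local_rep_def)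

lemma manifold_map_topspace: "manifold_map T A T' A' f \<Longrightarrow> p \<in> topspace T \<Longrightarrow> f p \<in> topspace T'"
  by (auto simp: manifold_map_def smooth_map_on_def continuous_map_def)

lemma rep_domain_open:
  assumes f: "manifold_map T A T' A' f" and "c \<in> A" "e \<in> A'"
  shows "open (rep_domain f c e)"
proof -
  have c: "is_chart T c" and e: "is_chart T' e"
    using assms by (auto simp: manifold_map_def smooth_manifold_chart)
  have "continuous_map T T' f" using f by (simp add: manifold_map_def smooth_map_on_def)
  then have "openin T {p \<in> topspace T. f p \<in> fst e}"
    using e by (simp add: continuous_map_def is_chart_def)
  from open_chart_image[OF c this]
  have "open (snd c ` (fst c \<inter> {p \<in> topspace T. f p \<in> fst e}))" .
  moreover have "fst c \<inter> {p \<in> topspace T. f p \<in> fst e} = {p \<in> fst c. f p \<in> fst e}"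
    using chart_subset_topspace[OF c] by auto
  ultimately show ?thesis by (simp add: rep_domain_def)
qed

lemma rep_domainI: "p \<in> fst c \<Longrightarrow> f p \<in> fst e \<Longrightarrow> snd c p \<in> rep_domain f c e"
  by (auto simp: rep_domain_def)

lemma rep_domainD:
  assumes "is_chart T c" "z \<in> rep_domain f c e"
  shows "inv_into (fst c) (snd c) z \<in> fst c" "f (inv_into (fst c) (snd c) z) \<in> fst e"
    "snd c (inv_into (fst c) (snd c) z) = z"
  using assms(2) chart_inverse[OF assms(1)] by (auto simp: rep_domain_def)

lemma local_rep_smooth:
  assumes f: "manifold_map T A T' A' f" and "c \<in> A" "e \<in> A'"
  shows "smooth_on (rep_domain f c e) (local_rep f c e)"
proof -
  have c: "is_chart T c" using assms by (auto simp: manifold_map_def smooth_manifold_chart)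
  have "{p \<in> fst c \<inter> topspace T. f p \<in> fst e} = {p \<in> fst c. f p \<in> fst e}"
    using chart_subset_topspace[OF c] by auto
  moreover have "smooth_on (snd c ` {p \<in> fst c \<inter> topspace T. f p \<in> fst e}) (local_rep f c e)"
    using assms unfolding manifold_map_def smooth_map_on_def local_rep_def by blast
  ultimately show ?thesis by (simp add: rep_domain_def)
qed

lemma local_rep_differentiable:
  assumes "manifold_map T A T' A' f" "c \<in> A" "e \<in> A'" "p \<in> fst c" "f p \<in> fst e"
  shows "local_rep f c e differentiable (at (snd c p))"
  by (rule smooth_on_differentiable[OF local_rep_smooth[OF assms(1-3)]]) (rule rep_domainI assms(4,5))+

lemma manifold_map_id:
  assumes A: "smooth_manifold T A" shows "manifold_map T A T A id"
proof -
  have "smooth_on (snd c ` {p \<in> fst c \<inter> topspace T. id p \<in> fst e}) (snd e \<circ> id \<circ> inv_into (fst c) (snd c))"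
    if "c \<in> A" "e \<in> A" for c e
  proof -
    have "{p \<in> fst c \<inter> topspace T. id p \<in> fst e} = fst c \<inter> fst e"
      using chart_subset_topspace[OF smooth_manifold_chart[OF A that(1)]] by auto
    then show ?thesis using A that by (simp add: smooth_manifold_def compatible_def transition_def)
  qed
  then show ?thesis using A by (simp add: manifold_map_def smooth_map_on_def)
qed

text \<open>The representation of the composite factors through the chart \<open>d\<close> only on
  \<open>rep_domain f c d\<close>; this is an open neighbourhood of the point, which suffices for
  derivatives.\<close>

lemma local_rep_chain:
  assumes f: "manifold_map T A T' A' f" and f': "manifold_map T' A' T'' A'' f'"
    and c: "c \<in> A" and d: "d \<in> A'" and e: "e \<in> A''"
    and p: "p \<in> fst c" "f p \<in> fst d" "f' (f p) \<in> fst e"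
  shows "frechet_derivative (local_rep (f' \<circ> f) c e) (at (snd c p)) a =
    frechet_derivative (local_rep f' d e) (at (snd d (f p))) (frechet_derivative (local_rep f c d) (at (snd c p)) a)"
proof -
  have cc: "is_chart T c" and dd: "is_chart T' d" using f f' c d by (auto simp: manifold_map_def smooth_manifold_chart)
  have val: "local_rep f c d (snd c p) = snd d (f p)" by (simp add: local_rep_def chart_inverse[OF cc p(1)])
  have 1: "local_rep (f' \<circ> f) c e w = local_rep f' d e (local_rep f c d w)" if "w \<in> rep_domain f c d" for w
    using rep_domainD[OF cc that] by (simp add: local_rep_def chart_inverse[OF dd])
  have 2: "((\<lambda>w. local_rep f' d e (local_rep f c d w)) has_derivative (\<lambda>a. frechet_derivative (local_rep f' d e) (at (snd d (f p)))
     (frechet_derivative (local_rep f c d) (at (snd c p)) a))) (at (snd c p))"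
    by (rule has_derivative_compose)
      (use local_rep_differentiable[OF f c d p(1,2)] local_rep_differentiable[OF f' d e p(2,3)] in
        \<open>simp_all add: val differentiable_has_frechet\<close>)
  show ?thesis
    by (subst frechet_derivative_cong_open[OF rep_domain_open[OF f c d] _ 1])
      (simp_all add: frechet_derivative_eqI[OF 2] rep_domainI p)
qed

section \<open>Tangent vectors, differentials and metrics in charts\<close>

lemma coord_vec_change:
  assumes A: "smooth_manifold T A" and "c \<in> A" "d \<in> A" "p \<in> fst c" "p \<in> fst d"
  shows "coord_vec A c p a = coord_vec A d p (frechet_derivative (transition c d) (at (snd c p)) a)"
  using local_rep_chain[OF manifold_map_id[OF A] manifold_map_id[OF A] assms(2,3), of _ p a] assms(4,5)
  by (auto simp: coord_vec_def fun_eq_iff transition_eq_local_rep)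

text \<open>\<open>differential\<close> is evaluated in a chart picked by choice around
  \<open>p\<close>. The chain rule with the identity before \<open>f\<close> removes this choice,
  and with the identity after \<open>f\<close> it translates between the charts \<open>d\<close> and
  \<open>e\<close> of the target.\<close>

lemma differential_coord_vec:
  assumes f: "manifold_map T A T' A' f" and c: "c \<in> A" and d: "d \<in> A'"
    and p: "p \<in> fst c" "f p \<in> fst d"
  shows "differential A A' f p (coord_vec A c p a) =
    coord_vec A' d (f p) (frechet_derivative (local_rep f c d) (at (snd c p)) a)"
proof
  fix e
  have A: "smooth_manifold T A" "smooth_manifold T' A'" using f by (auto simp: manifold_map_def)
  have "p \<in> topspace T" using chart_subset_topspace[OF smooth_manifold_chart[OF A(1) c]] p by auto
  note c0 = chart_at_props[OF A(1) this]
  show "differential A A' f p (coord_vec A c p a) e =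
    coord_vec A' d (f p) (frechet_derivative (local_rep f c d) (at (snd c p)) a) e"
  proof (cases "e \<in> A' \<and> f p \<in> fst e")
    case True
    have "frechet_derivative (local_rep f (chart_at A p) e) (at (snd (chart_at A p) p))
        (frechet_derivative (transition c (chart_at A p)) (at (snd c p)) a)
      = frechet_derivative (local_rep f c e) (at (snd c p)) a"
      using local_rep_chain[OF manifold_map_id[OF A(1)] f c c0(1), of e p a] True p c0
      by (simp add: transition_eq_local_rep)
    moreover have "frechet_derivative (transition d e) (at (snd d (f p)))
        (frechet_derivative (local_rep f c d) (at (snd c p)) a)
      = frechet_derivative (local_rep f c e) (at (snd c p)) a"
      using local_rep_chain[OF f manifold_map_id[OF A(2)] c d, of e p a] True p
      by (simp add: transition_eq_local_rep)
    ultimately show ?thesis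
      using True c0 by (simp add: differential_def coord_vec_def Let_def local_rep_def[symmetric])
  qed (auto simp: differential_def coord_vec_def Let_def)
qed

lemma coord_vec_self:
  assumes A: "smooth_manifold T A" and c: "c \<in> A" "p \<in> fst c"
  shows "coord_vec A c p a c = a"
proof -
  have cc: "is_chart T c" using A c by (simp add: smooth_manifold_chart)
  have "frechet_derivative (transition c c) (at (snd c p)) = frechet_derivative (\<lambda>z. z) (at (snd c p))"
  proof (rule frechet_derivative_cong_open)
    show "open (snd c ` fst c)" using cc by (simp add: is_chart_def)
  qed (use c in \<open>auto simp: transition_def chart_inverse[OF cc]\<close>)
  then show ?thesis using c by (simp add: coord_vec_def)
qed

lemma coord_vec_eq_0_iff:
  assumes A: "smooth_manifold T A" and c: "c \<in> A" "p \<in> fst c"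
  shows "coord_vec A c p a = (\<lambda>_. 0) \<longleftrightarrow> a = 0"
proof
  assume "coord_vec A c p a = (\<lambda>_. 0)"
  then show "a = 0" using coord_vec_self[OF A c, of a] by simp
next
  assume [simp]: "a = 0"
  have "frechet_derivative (transition c e) (at (snd c p)) 0 = 0" if "e \<in> A" "p \<in> fst e" for e
    using local_rep_differentiable[OF manifold_map_id[OF A] c(1) that(1), of p] c that
    by (simp add: transition_eq_local_rep linear_0[OF linear_frechet_derivative])
  then show "coord_vec A c p a = (\<lambda>_. 0)" by (auto simp: coord_vec_def)
qed

lemma coord_vec_in_tangent_space: "c \<in> A \<Longrightarrow> p \<in> fst c \<Longrightarrow> coord_vec A c p a \<in> tangent_space A p"
  unfolding tangent_space_def by blast

lemma tangent_space_coord_vec: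
  assumes A: "smooth_manifold T A" and c: "c \<in> A" "p \<in> fst c" and v: "v \<in> tangent_space A p"
  shows "v = coord_vec A c p (v c)"
proof -
  obtain d a where d: "d \<in> A" "p \<in> fst d" "v = coord_vec A d p a"
    using v by (auto simp: tangent_space_def)
  have "v = coord_vec A c p (frechet_derivative (transition d c) (at (snd d p)) a)"
    unfolding d(3) by (rule coord_vec_change[OF A d(1) c(1) d(2) c(2)])
  then show ?thesis using coord_vec_self[OF A c] by metis
qed

lemma bilinear_expansion:
  fixes B :: "real^'n \<Rightarrow> real^'m \<Rightarrow> real"
  assumes "bilinear B"
  shows "B a b = (\<Sum>i\<in>UNIV. \<Sum>j\<in>UNIV. B (axis i 1) (axis j 1) * a $ i * b $ j)"
proof -
  have rep: "x = (\<Sum>i\<in>UNIV. x $ i *\<^sub>R axis i 1)" for x :: "real^'k"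
    by (simp add: vec_eq_iff axis_def if_distrib cong: if_cong)
  have "B a b = B (\<Sum>i\<in>UNIV. a $ i *\<^sub>R axis i 1) (\<Sum>j\<in>UNIV. b $ j *\<^sub>R axis j 1)"
    using rep[of a] rep[of b] by simp
  also have "\<dots> = (\<Sum>(i, j)\<in>UNIV \<times> UNIV. B (a $ i *\<^sub>R axis i 1) (b $ j *\<^sub>R axis j 1))"
    by (rule bilinear_sum[OF assms])
  also have "\<dots> = (\<Sum>i\<in>UNIV. \<Sum>j\<in>UNIV. B (axis i 1) (axis j 1) * a $ i * b $ j)"
    by (simp add: sum.cartesian_product bilinear_lmul[OF assms] bilinear_rmul[OF assms] mult_ac)
  finally show ?thesis .
qed

lemma frechet_derivative_expansion:
  fixes F :: "real^'n \<Rightarrow> 'b::real_normed_vector"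
  assumes "F differentiable (at z)"
  shows "frechet_derivative F (at z) a = (\<Sum>i\<in>UNIV. a $ i *\<^sub>R frechet_derivative F (at z) (axis i 1))"
proof -
  have l: "linear (frechet_derivative F (at z))" using assms by (rule linear_frechet_derivative)
  have "a = (\<Sum>i\<in>UNIV. a $ i *\<^sub>R axis i 1)" by (simp add: vec_eq_iff axis_def if_distrib cong: if_cong)
  then have "frechet_derivative F (at z) a = frechet_derivative F (at z) (\<Sum>i\<in>UNIV. a $ i *\<^sub>R axis i 1)"
    by simp
  then show ?thesis by (simp only: linear_sum[OF l] linear_scale[OF l])
qed

definition metric_quad :: "real^'n^'n \<Rightarrow> real^'n \<Rightarrow> real^'n \<Rightarrow> real" where
  "metric_quad H a b = (\<Sum>i\<in>UNIV. \<Sum>j\<in>UNIV. H $ i $ j * a $ i * b $ j)"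

lemma metric_quad_axis [simp]: "metric_quad H (axis i 1) (axis j 1) = H $ i $ j"
proof -
  have "H $ i' $ j' * axis i 1 $ i' * axis j 1 $ j' = (if j' = j then (if i' = i then H $ i $ j else 0) else 0)"
    for i' j' by (auto simp: axis_def)
  then show ?thesis by (simp add: metric_quad_def)
qed

lemma metric_coord_vec:
  assumes c: "is_chart T c" "p \<in> fst c"
    and B: "bilinear (\<lambda>a b. g p (coord_vec A c p a) (coord_vec A c p b))"
  shows "g p (coord_vec A c p a) (coord_vec A c p b) = metric_quad (metric_comp A g c (snd c p)) a b"
  using bilinear_expansion[OF B, of a b]
  by (simp add: metric_quad_def metric_comp_def chart_inverse[OF c])

lemma riemannian_metric_coord_vec:
  assumes "riemannian_manifold T A g" "c \<in> A" "p \<in> fst c"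
  shows "g p (coord_vec A c p a) (coord_vec A c p b) = metric_quad (metric_comp A g c (snd c p)) a b"
  using assms by (intro metric_coord_vec[of T])
    (auto simp: riemannian_manifold_def riemannian_metric_def smooth_manifold_chart)

text \<open>Continuity keeps the curve in any other chart \<open>e\<close> around the point for an
  open set of times, and there the chain rule for the transition map gives the components.\<close>

lemma velocity_coord_vec:
  assumes A: "smooth_manifold T A" and c: "c \<in> A"
    and J: "open J" "s \<in> J" "\<And>t. t \<in> J \<Longrightarrow> \<alpha> t \<in> fst c" "continuous_map (top_of_set J) T \<alpha>"
    and d: "(snd c \<circ> \<alpha>) differentiable (at s)"
  shows "velocity A \<alpha> s = coord_vec A c (\<alpha> s) (vector_derivative (snd c \<circ> \<alpha>) (at s))"
proof
  fix e
  show "velocity A \<alpha> s e = coord_vec A c (\<alpha> s) (vector_derivative (snd c \<circ> \<alpha>) (at s)) e"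
  proof (cases "e \<in> A \<and> \<alpha> s \<in> fst e")
    case True
    have cc: "is_chart T c" and ee: "is_chart T e" using A c True by (auto simp: smooth_manifold_chart)
    have "openin (top_of_set J) {t \<in> J. \<alpha> t \<in> fst e}"
      using J(4) ee by (simp add: continuous_map_def is_chart_def)
    then have U: "open {t \<in> J. \<alpha> t \<in> fst e}" using J(1) openin_open_eq by blast
    have "((snd c \<circ> \<alpha>) has_vector_derivative vector_derivative (snd c \<circ> \<alpha>) (at s)) (at s)"
      using d by (simp add: vector_derivative_works)
    moreover have "(transition c e has_derivative frechet_derivative (transition c e) (at (snd c (\<alpha> s)))) (at ((snd c \<circ> \<alpha>) s))"
      using local_rep_differentiable[OF manifold_map_id[OF A] c, of e "\<alpha> s"] True J
      by (simp add: transition_eq_local_rep differentiable_has_frechet)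
    ultimately have "((\<lambda>t. transition c e ((snd c \<circ> \<alpha>) t)) has_derivative
        (\<lambda>x. frechet_derivative (transition c e) (at (snd c (\<alpha> s))) (x *\<^sub>R vector_derivative (snd c \<circ> \<alpha>) (at s)))) (at s)"
      unfolding has_vector_derivative_def by (rule has_derivative_compose)
    moreover have "linear (frechet_derivative (transition c e) (at (snd c (\<alpha> s))))"
      using local_rep_differentiable[OF manifold_map_id[OF A] c, of e "\<alpha> s"] True J
      by (simp add: transition_eq_local_rep linear_frechet_derivative)
    ultimately have "((\<lambda>t. transition c e ((snd c \<circ> \<alpha>) t)) has_vector_derivative
        frechet_derivative (transition c e) (at (snd c (\<alpha> s))) (vector_derivative (snd c \<circ> \<alpha>) (at s))) (at s)"
      by (simp add: has_vector_derivative_def linear_scale)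
    then have "((snd e \<circ> \<alpha>) has_vector_derivative
        frechet_derivative (transition c e) (at (snd c (\<alpha> s))) (vector_derivative (snd c \<circ> \<alpha>) (at s))) (at s)"
      by (rule has_vector_derivative_transform_within_open[OF _ U])
        (use True J in \<open>auto simp: transition_def chart_inverse[OF cc]\<close>)
    then show ?thesis using True by (simp add: velocity_def coord_vec_def vector_derivative_at)
  qed (auto simp: velocity_def coord_vec_def)
qed

section \<open>The flow of a Killing field\<close>

text \<open>Time is kept as a coordinate beside the chart coordinates, so that the derivatives in
  time and in a chart direction belong to one smooth map and can be interchanged.\<close>

definition action_rep :: "(real \<Rightarrow> 'p \<Rightarrow> 'p) \<Rightarrow> ('p, 'd::finite) chart \<Rightarrow> ('p, 'd) chart \<Rightarrow> real \<times> (real^'d) \<Rightarrow> real^'d"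
  where "action_rep \<phi> c e = (\<lambda>(t, z). snd e (\<phi> t (inv_into (fst c) (snd c) z)))"

definition action_domain :: "(real \<Rightarrow> 'p \<Rightarrow> 'p) \<Rightarrow> ('p, 'd::finite) chart \<Rightarrow> ('p, 'd) chart \<Rightarrow> (real \<times> (real^'d)) set"
  where "action_domain \<phi> c e = {(t, z). z \<in> snd c ` fst c \<and> \<phi> t (inv_into (fst c) (snd c) z) \<in> fst e}"

lemma action_rep_smooth:
  "smooth_real_action T A \<phi> \<Longrightarrow> c \<in> A \<Longrightarrow> e \<in> A \<Longrightarrow> smooth_on (action_domain \<phi> c e) (action_rep \<phi> c e)"
  unfolding smooth_real_action_def action_domain_def action_rep_def by blast

lemma action_domain_open:
  fixes A :: "('p, 'd::finite) chart set"
  assumes A: "smooth_manifold T A" and \<phi>: "smooth_real_action T A \<phi>" and c: "c \<in> A" and e: "e \<in> A"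
  shows "open (action_domain \<phi> c e)"
proof -
  have cc: "is_chart T c" and ee: "is_chart T e" using A c e by (auto simp: smooth_manifold_chart)
  let ?S = "UNIV \<times> snd c ` fst c :: (real \<times> (real^'d)) set"
  have oS: "open ?S" using cc by (simp add: is_chart_def open_Times)
  have "continuous_map (prod_topology euclideanreal (top_of_set (snd c ` fst c))) (prod_topology euclideanreal T)
      (\<lambda>(t, z). (t, inv_into (fst c) (snd c) z))"
    unfolding continuous_map_prod_top using chart_inverse_continuous[OF cc] by simp
  moreover have "prod_topology euclideanreal (top_of_set (snd c ` fst c)) = top_of_set ?S"
    using prod_topology_subtopology_eu[of "UNIV :: real set" "snd c ` fst c"] by simp
  ultimately have "continuous_map (top_of_set ?S) (prod_topology euclideanreal T)
      (\<lambda>(t, z). (t, inv_into (fst c) (snd c) z))" by simp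
  moreover have "continuous_map (prod_topology euclideanreal T) T (\<lambda>(t, p). \<phi> t p)"
    using \<phi> by (simp add: smooth_real_action_def)
  ultimately have "continuous_map (top_of_set ?S) T
      ((\<lambda>(t, p). \<phi> t p) \<circ> (\<lambda>(t, z). (t, inv_into (fst c) (snd c) z)))"
    by (rule continuous_map_compose)
  from openin_continuous_map_preimage[OF this]
  have "openin (top_of_set ?S) {x \<in> topspace (top_of_set ?S).
      ((\<lambda>(t, p). \<phi> t p) \<circ> (\<lambda>(t, z). (t, inv_into (fst c) (snd c) z))) x \<in> fst e}"
    using ee unfolding is_chart_def by blast
  moreover have "{x \<in> topspace (top_of_set ?S).
      ((\<lambda>(t, p). \<phi> t p) \<circ> (\<lambda>(t, z). (t, inv_into (fst c) (snd c) z))) x \<in> fst e} = action_domain \<phi> c e"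
    by (auto simp: action_domain_def)
  ultimately show ?thesis using oS by (simp add: openin_open_eq)
qed

lemma action_topspace:
  assumes "smooth_real_action T A \<phi>" "p \<in> topspace T"
  shows "\<phi> t p \<in> topspace T"
proof -
  have "continuous_map (prod_topology euclideanreal T) T (\<lambda>(t, p). \<phi> t p)"
    using assms(1) by (simp add: smooth_real_action_def)
  from funcset_mem[OF continuous_map_funspace[OF this], of "(t, p)"] show ?thesis using assms(2) by simp
qed

lemma Ck_on_Pair_right: "open S \<Longrightarrow> Ck_on k S (\<lambda>w::'a::euclidean_space. (t::real, w))"
proof -
  assume S: "open S"
  have "bounded_linear (\<lambda>w::'a. (0::real, w))"
    by (intro bounded_linear_Pair bounded_linear_zero bounded_linear_ident)
  from Ck_on_add[OF S Ck_on_const[of _ _ "(t, 0)"] Ck_on_bounded_linear[OF this]]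
  show ?thesis by simp
qed

lemma action_manifold_map:
  fixes \<phi> :: "real \<Rightarrow> 'p \<Rightarrow> 'p" and A :: "('p, 'd::finite) chart set"
  assumes A: "smooth_manifold T A" and \<phi>: "smooth_real_action T A \<phi>"
  shows "manifold_map T A T A (\<phi> t)"
proof -
  have "continuous_map T (prod_topology euclideanreal T) (\<lambda>p. (t, p))"
    by (simp add: continuous_map_pairwise o_def)
  moreover have "continuous_map (prod_topology euclideanreal T) T (\<lambda>(t, p). \<phi> t p)"
    using \<phi> by (simp add: smooth_real_action_def)
  ultimately have "continuous_map T T ((\<lambda>(t, p). \<phi> t p) \<circ> (\<lambda>p. (t, p)))" by (rule continuous_map_compose)
  then have 1: "continuous_map T T (\<phi> t)" by (simp add: o_def)
  have 2: "smooth_on (snd c ` {p \<in> fst c \<inter> topspace T. \<phi> t p \<in> fst e}) (snd e \<circ> \<phi> t \<circ> inv_into (fst c) (snd c))"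
    if "c \<in> A" "e \<in> A" for c e
  proof -
    have cc: "is_chart T c" using A that by (auto simp: smooth_manifold_chart)
    let ?S = "(\<lambda>w. (t, w)) -` action_domain \<phi> c e"
    have S: "open ?S"
      by (intro continuous_open_vimage action_domain_open[OF A \<phi> that]) (auto intro!: continuous_intros)
    have "snd c ` {p \<in> fst c \<inter> topspace T. \<phi> t p \<in> fst e} = ?S"
      using chart_inverse[OF cc] chart_subset_topspace[OF cc] by (auto simp: action_domain_def image_iff)
    moreover have "smooth_on ?S (\<lambda>w. action_rep \<phi> c e (t, w))"
      by (rule smooth_on_compose[OF S action_domain_open[OF A \<phi> that] _ _ action_rep_smooth[OF \<phi> that]])
        (auto simp: smooth_on_def Ck_on_Pair_right[OF S])
    ultimately show ?thesis by (simp add: action_rep_def o_def)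
  qed
  show ?thesis using A 1 2 by (simp add: manifold_map_def smooth_map_on_def)
qed

lemma has_derivative_Pair_right: "((\<lambda>w. (t, w)) has_derivative (\<lambda>a. (0, a))) (at z)"
  by (intro derivative_eq_intros) auto

lemma local_rep_action_frechet:
  assumes "action_rep \<phi> c e differentiable (at (t, z))"
  shows "frechet_derivative (local_rep (\<phi> t) c e) (at z) a = frechet_derivative (action_rep \<phi> c e) (at (t, z)) (0, a)"
proof -
  have "local_rep (\<phi> t) c e = (\<lambda>w. action_rep \<phi> c e (t, w))"
    by (simp add: local_rep_def action_rep_def fun_eq_iff)
  moreover have "((\<lambda>w. action_rep \<phi> c e (t, w)) has_derivative
      (\<lambda>a. frechet_derivative (action_rep \<phi> c e) (at (t, z)) (0, a))) (at z)"
    by (rule has_derivative_compose[OF has_derivative_Pair_right differentiable_has_frechet[OF assms]])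
  ultimately show ?thesis by (simp add: frechet_derivative_eqI)
qed

lemma action_path_derivative:
  assumes "F differentiable (at (s, z))"
  shows "((\<lambda>s. F (s, z)) has_vector_derivative frechet_derivative F (at (s, z)) (1, 0)) (at s)"
proof -
  have "((\<lambda>s. (s, z)) has_derivative (\<lambda>x. (x, 0))) (at s)" by (intro derivative_eq_intros) auto
  from has_derivative_compose[OF this differentiable_has_frechet[OF assms]]
  have "((\<lambda>s. F (s, z)) has_derivative (\<lambda>x. frechet_derivative F (at (s, z)) (x, 0))) (at s)" .
  moreover have "(\<lambda>x. frechet_derivative F (at (s, z)) (x, 0)) = (\<lambda>x. x *\<^sub>R frechet_derivative F (at (s, z)) (1, 0))"
  proof
    show "frechet_derivative F (at (s, z)) (x, 0) = x *\<^sub>R frechet_derivative F (at (s, z)) (1, 0)" for x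
      using linear_scale[OF linear_frechet_derivative[OF assms], of x "(1, 0)"] by simp
  qed
  ultimately show ?thesis unfolding has_vector_derivative_def by (rule has_derivative_eq_rhs)
qed

text \<open>This is the flow equation as an ordinary differential equation in coordinates.
  Differentiating it in the initial point yields the variational equation behind the invariance of
  the metric.\<close>

lemma action_rep_time_derivative:
  assumes N: "smooth_manifold T A" and flow: "flow_of T A X \<phi>" and n: "n \<in> A" and k: "k \<in> A"
    and w: "w \<in> action_domain \<phi> n k"
  shows "frechet_derivative (action_rep \<phi> n k) (at w) (1, 0) = vfield_comp X k (action_rep \<phi> n k w)"
proof -
  obtain s z where sz: "w = (s, z)" by force
  have nn: "is_chart T n" and kk: "is_chart T k" using N n k by (auto simp: smooth_manifold_chart)
  have \<phi>: "smooth_real_action T A \<phi>" using flow by (simp add: flow_of_def)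
  obtain p where p: "p \<in> fst n" "z = snd n p" "\<phi> s p \<in> fst k"
    using w chart_inverse[OF nn] by (auto simp: action_domain_def sz)
  have "action_rep \<phi> n k differentiable (at (s, z))"
    using smooth_on_differentiable[OF action_rep_smooth[OF \<phi> n k] w] by (simp add: sz)
  then have "((\<lambda>s. action_rep \<phi> n k (s, z)) has_vector_derivative
      frechet_derivative (action_rep \<phi> n k) (at (s, z)) (1, 0)) (at s)"
    by (rule action_path_derivative)
  moreover have "(\<lambda>s. action_rep \<phi> n k (s, z)) = snd k \<circ> (\<lambda>r. \<phi> r p)"
    by (simp add: action_rep_def p chart_inverse[OF nn] fun_eq_iff)
  ultimately have "vector_derivative (snd k \<circ> (\<lambda>r. \<phi> r p)) (at s) = frechet_derivative (action_rep \<phi> n k) (at (s, z)) (1, 0)"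
    by (simp add: vector_derivative_at)
  moreover have "velocity A (\<lambda>r. \<phi> r p) s = X (\<phi> s p)"
    using flow p chart_subset_topspace[OF nn] by (auto simp: flow_of_def)
  then have "velocity A (\<lambda>r. \<phi> r p) s k = X (\<phi> s p) k" by (rule fun_cong)
  then have "X (\<phi> s p) k = vector_derivative (snd k \<circ> (\<lambda>r. \<phi> r p)) (at s)"
    using k p by (simp add: velocity_def)
  moreover have "vfield_comp X k (action_rep \<phi> n k (s, z)) = X (\<phi> s p) k"
    by (simp add: vfield_comp_def action_rep_def p chart_inverse[OF nn] chart_inverse[OF kk])
  ultimately show ?thesis by (simp add: sz)
qed

section \<open>Invariance of the metric under the flow\<close>

lemma metric_quad_has_derivative:
  assumes G: "\<And>i j. ((\<lambda>s. G s $ i $ j) has_real_derivative G' $ i $ j) (at s)"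
    and A: "(A has_vector_derivative A') (at s)" and B: "(B has_vector_derivative B') (at s)"
  shows "((\<lambda>s. metric_quad (G s) (A s) (B s)) has_real_derivative
    metric_quad G' (A s) (B s) + metric_quad (G s) A' (B s) + metric_quad (G s) (A s) B') (at s)"
proof -
  have A: "((\<lambda>s. A s $ i) has_real_derivative A' $ i) (at s)"
    and B: "((\<lambda>s. B s $ i) has_real_derivative B' $ i) (at s)" for i
    using bounded_linear.has_vector_derivative[OF bounded_linear_vec_nth A]
      bounded_linear.has_vector_derivative[OF bounded_linear_vec_nth B]
    by (auto simp: has_real_derivative_iff_has_vector_derivative)
  show ?thesis unfolding metric_quad_def sum.distrib[symmetric]
    by (intro DERIV_sum) (auto intro!: derivative_eq_intros G A B simp: algebra_simps)
qed

text \<open>The Killing equation is multiplied by the components of \<open>a\<close> and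
  \<open>b\<close> and summed. \<open>dG l\<close> and \<open>d\<xi> l\<close> stand for the l-th
  partial derivatives of the metric and of the field, so the three terms are those of the product
  rule when two vectors are transported by the flow.\<close>

lemma killing_contraction:
  fixes G :: "real^'n^'n" and a b \<xi> :: "real^'n" and dG :: "'n \<Rightarrow> real^'n^'n" and d\<xi> :: "'n \<Rightarrow> real^'n"
  assumes K: "\<And>i j. (\<Sum>l\<in>UNIV. \<xi> $ l * dG l $ i $ j + G $ l $ j * d\<xi> i $ l + G $ i $ l * d\<xi> j $ l) = 0"
  shows "metric_quad (\<Sum>l\<in>UNIV. \<xi> $ l *\<^sub>R dG l) a b + metric_quad G (\<Sum>l\<in>UNIV. a $ l *\<^sub>R d\<xi> l) b
    + metric_quad G a (\<Sum>l\<in>UNIV. b $ l *\<^sub>R d\<xi> l) = 0"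
proof -
  have 1: "metric_quad (\<Sum>l\<in>UNIV. \<xi> $ l *\<^sub>R dG l) a b
      = (\<Sum>i\<in>UNIV. \<Sum>j\<in>UNIV. \<Sum>l\<in>UNIV. \<xi> $ l * dG l $ i $ j * (a $ i * b $ j))"
    by (simp add: metric_quad_def sum_distrib_left sum_distrib_right mult_ac)
  have "metric_quad G (\<Sum>l\<in>UNIV. a $ l *\<^sub>R d\<xi> l) b
      = (\<Sum>l\<in>UNIV. \<Sum>j\<in>UNIV. \<Sum>i\<in>UNIV. G $ l $ j * d\<xi> i $ l * (a $ i * b $ j))"
    by (simp add: metric_quad_def sum_distrib_left sum_distrib_right mult_ac)
  also have "\<dots> = (\<Sum>l\<in>UNIV. \<Sum>i\<in>UNIV. \<Sum>j\<in>UNIV. G $ l $ j * d\<xi> i $ l * (a $ i * b $ j))"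
    by (intro sum.cong refl sum.swap)
  also have "\<dots> = (\<Sum>i\<in>UNIV. \<Sum>l\<in>UNIV. \<Sum>j\<in>UNIV. G $ l $ j * d\<xi> i $ l * (a $ i * b $ j))"
    by (rule sum.swap)
  also have "\<dots> = (\<Sum>i\<in>UNIV. \<Sum>j\<in>UNIV. \<Sum>l\<in>UNIV. G $ l $ j * d\<xi> i $ l * (a $ i * b $ j))"
    by (intro sum.cong refl sum.swap)
  finally have 2: "metric_quad G (\<Sum>l\<in>UNIV. a $ l *\<^sub>R d\<xi> l) b = \<dots>" .
  have "metric_quad G a (\<Sum>l\<in>UNIV. b $ l *\<^sub>R d\<xi> l)
      = (\<Sum>i\<in>UNIV. \<Sum>l\<in>UNIV. \<Sum>j\<in>UNIV. G $ i $ l * d\<xi> j $ l * (a $ i * b $ j))"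
    by (simp add: metric_quad_def sum_distrib_left mult_ac)
  also have "\<dots> = (\<Sum>i\<in>UNIV. \<Sum>j\<in>UNIV. \<Sum>l\<in>UNIV. G $ i $ l * d\<xi> j $ l * (a $ i * b $ j))"
    by (intro sum.cong refl sum.swap)
  finally have 3: "metric_quad G a (\<Sum>l\<in>UNIV. b $ l *\<^sub>R d\<xi> l) = \<dots>" .
  have "(\<Sum>i\<in>UNIV. \<Sum>j\<in>UNIV. \<Sum>l\<in>UNIV. \<xi> $ l * dG l $ i $ j * (a $ i * b $ j)) +
      (\<Sum>i\<in>UNIV. \<Sum>j\<in>UNIV. \<Sum>l\<in>UNIV. G $ l $ j * d\<xi> i $ l * (a $ i * b $ j)) +
      (\<Sum>i\<in>UNIV. \<Sum>j\<in>UNIV. \<Sum>l\<in>UNIV. G $ i $ l * d\<xi> j $ l * (a $ i * b $ j))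
    = (\<Sum>i\<in>UNIV. \<Sum>j\<in>UNIV. (\<Sum>l\<in>UNIV. \<xi> $ l * dG l $ i $ j + G $ l $ j * d\<xi> i $ l + G $ i $ l * d\<xi> j $ l) * (a $ i * b $ j))"
    by (simp only: sum.distrib sum_distrib_right distrib_right)
  then show ?thesis unfolding 1 2 3 K by simp
qed

text \<open>Interchanging the derivatives along the flow and along \<open>a\<close> turns the
  derivative of the pulled back metric in \<open>s\<close> into the contraction of the Killing equation.\<close>

lemma killing_flow_metric_derivative:
  assumes N: "riemannian_manifold T A g" and X: "killing_field T A g X" and flow: "flow_of T A X \<phi>"
    and n: "n \<in> A" and k: "k \<in> A" and sz: "(s, z) \<in> action_domain \<phi> n k"
  defines "Y \<equiv> action_rep \<phi> n k"
  shows "((\<lambda>s. metric_quad (metric_comp A g k (Y (s, z)))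
      (frechet_derivative Y (at (s, z)) (0, a)) (frechet_derivative Y (at (s, z)) (0, b))) has_real_derivative 0) (at s)"
proof -
  define W where "W = action_domain \<phi> n k"
  have mf: "smooth_manifold T A" using N by (simp add: riemannian_manifold_def)
  have kk: "is_chart T k" and nn: "is_chart T n" using mf n k by (auto simp: smooth_manifold_chart)
  have \<phi>: "smooth_real_action T A \<phi>" using flow by (simp add: flow_of_def)
  have W: "open W" unfolding W_def by (rule action_domain_open[OF mf \<phi> n k])
  have szW: "(s, z) \<in> W" using sz by (simp add: W_def)
  have Y: "smooth_on W Y" unfolding W_def Y_def by (rule action_rep_smooth[OF \<phi> n k])
  define G where "G = metric_comp A g k"
  define \<xi> where "\<xi> = vfield_comp X k"
  have G: "smooth_on (snd k ` fst k) G"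
    using N k by (auto simp: G_def riemannian_manifold_def riemannian_metric_def)
  have \<xi>: "smooth_on (snd k ` fst k) \<xi>"
    using X k by (auto simp: \<xi>_def killing_field_def smooth_vfield_def)
  have Yin: "Y w \<in> snd k ` fst k" if "w \<in> W" for w
    using that by (auto simp: W_def Y_def action_rep_def action_domain_def)
  have dY: "Y differentiable (at w)" if "w \<in> W" for w using smooth_on_differentiable[OF Y that] .
  have d\<xi>: "\<xi> differentiable (at (Y w))" if "w \<in> W" for w using smooth_on_differentiable[OF \<xi> Yin[OF that]] .
  have dG: "G differentiable (at (Y w))" if "w \<in> W" for w using smooth_on_differentiable[OF G Yin[OF that]] .
  have Yt: "frechet_derivative Y (at w) (1, 0) = \<xi> (Y w)" if "w \<in> W" for w
    using action_rep_time_derivative[OF mf flow n k] that by (simp add: W_def Y_def \<xi>_def)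
  have path: "((\<lambda>s. Y (s, z)) has_vector_derivative \<xi> (Y (s, z))) (at s)"
    using action_path_derivative[OF dY[OF szW]] by (simp add: Yt[OF szW])
  define d\<xi>l where "d\<xi>l l = frechet_derivative \<xi> (at (Y (s, z))) (axis l 1)" for l
  define dGl where "dGl l = frechet_derivative G (at (Y (s, z))) (axis l 1)" for l
  \<comment> \<open>The variational equation: a vector transported by the flow changes at the rate
    given by the derivative of the field along it.\<close>
  have var: "((\<lambda>s. frechet_derivative Y (at (s, z)) (0, a)) has_vector_derivative
      (\<Sum>l\<in>UNIV. frechet_derivative Y (at (s, z)) (0, a) $ l *\<^sub>R d\<xi>l l)) (at s)" for a
  proof -
    have "smooth_on W (\<lambda>w. frechet_derivative Y (at w) (0, a))" by (rule smooth_on_frechet[OF Y])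
    from action_path_derivative[OF smooth_on_differentiable[OF this szW]]
    have "((\<lambda>s. frechet_derivative Y (at (s, z)) (0, a)) has_vector_derivative
      frechet_derivative (\<lambda>w. frechet_derivative Y (at w) (0, a)) (at (s, z)) (1, 0)) (at s)" .
    also have "frechet_derivative (\<lambda>w. frechet_derivative Y (at w) (0, a)) (at (s, z)) (1, 0) =
      frechet_derivative (\<lambda>w. frechet_derivative Y (at w) (1, 0)) (at (s, z)) (0, a)"
      by (rule second_derivative_symmetric[OF smooth_on_imp_Ck[OF Y] W szW])
    also have "frechet_derivative (\<lambda>w. frechet_derivative Y (at w) (1, 0)) (at (s, z)) =
      frechet_derivative (\<lambda>w. \<xi> (Y w)) (at (s, z))"
      by (rule frechet_derivative_cong_open[OF W szW Yt])
    also have "\<dots> = (\<lambda>a. frechet_derivative \<xi> (at (Y (s, z))) (frechet_derivative Y (at (s, z)) a))"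
      by (intro frechet_derivative_eqI has_derivative_compose[of Y _ _ UNIV \<xi>] differentiable_has_frechet dY d\<xi> szW)
    also have "frechet_derivative \<xi> (at (Y (s, z))) (frechet_derivative Y (at (s, z)) (0, a)) =
      (\<Sum>l\<in>UNIV. frechet_derivative Y (at (s, z)) (0, a) $ l *\<^sub>R d\<xi>l l)"
      unfolding d\<xi>l_def by (rule frechet_derivative_expansion[OF d\<xi>[OF szW]])
    finally show ?thesis .
  qed
  have Gpath: "((\<lambda>s. G (Y (s, z)) $ i $ j) has_real_derivative (\<Sum>l\<in>UNIV. \<xi> (Y (s, z)) $ l *\<^sub>R dGl l) $ i $ j) (at s)" for i j
  proof -
    have "((\<lambda>s. G (Y (s, z))) has_derivative
        (\<lambda>x. frechet_derivative G (at (Y (s, z))) (x *\<^sub>R \<xi> (Y (s, z))))) (at s)"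
      by (rule has_derivative_compose[OF path[unfolded has_vector_derivative_def] differentiable_has_frechet[OF dG[OF szW]]])
    then have "((\<lambda>s. G (Y (s, z))) has_vector_derivative (frechet_derivative G (at (Y (s, z))) (\<xi> (Y (s, z))))) (at s)"
      by (simp add: has_vector_derivative_def linear_scale[OF linear_frechet_derivative[OF dG[OF szW]]])
    then have "((\<lambda>s. G (Y (s, z))) has_vector_derivative (\<Sum>l\<in>UNIV. \<xi> (Y (s, z)) $ l *\<^sub>R dGl l)) (at s)"
      unfolding dGl_def frechet_derivative_expansion[OF dG[OF szW], of "\<xi> (Y (s, z))"] .
    from bounded_linear.has_vector_derivative[OF bounded_linear_vec_nth
        bounded_linear.has_vector_derivative[OF bounded_linear_vec_nth this]]
    show ?thesis by (simp add: has_real_derivative_iff_has_vector_derivative)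
  qed
  have "(\<Sum>l\<in>UNIV. \<xi> (Y (s, z)) $ l * dGl l $ i $ j + G (Y (s, z)) $ l $ j * d\<xi>l i $ l
      + G (Y (s, z)) $ i $ l * d\<xi>l j $ l) = 0" for i j
  proof -
    have "partial l (\<lambda>w. G w $ i $ j) (Y (s, z)) = dGl l $ i $ j" for l i j
      unfolding partial_def dGl_def
      by (rule fun_cong[OF frechet_linear_comp[OF _ dG[OF szW]], of "\<lambda>h. h $ i $ j"])
        (rule bounded_linear_compose[OF bounded_linear_vec_nth bounded_linear_vec_nth])
    moreover have "partial i (\<lambda>w. \<xi> w $ l) (Y (s, z)) = d\<xi>l i $ l" for l i
      unfolding partial_def d\<xi>l_def
      by (rule fun_cong[OF frechet_linear_comp[OF bounded_linear_vec_nth d\<xi>[OF szW]]])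
    moreover have "(\<Sum>l\<in>UNIV. \<xi> (Y (s, z)) $ l * partial l (\<lambda>w. G w $ i $ j) (Y (s, z))
                + G (Y (s, z)) $ l $ j * partial i (\<lambda>w. \<xi> w $ l) (Y (s, z))
                + G (Y (s, z)) $ i $ l * partial j (\<lambda>w. \<xi> w $ l) (Y (s, z))) = 0"
      using X k Yin[OF szW] unfolding killing_field_def Let_def G_def \<xi>_def by blast
    ultimately show ?thesis by simp
  qed
  from killing_contraction[OF this]
  show ?thesis
    using metric_quad_has_derivative[OF Gpath var[of a] var[of b]]
    by (simp add: G_def)
qed

text \<open>The product of the transported vectors, as a function \<open>H\<close> of time, has zero
  derivative at every time and not just at 0. Hence it is constant, and at time 0 the flow is the
  identity.\<close>

lemma killing_flow_isometry:
  assumes N: "riemannian_manifold T A g" and X: "killing_field T A g X" and flow: "flow_of T A X \<phi>"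
    and p: "p \<in> topspace T" and v: "v \<in> tangent_space A p" and w: "w \<in> tangent_space A p"
  shows "g (\<phi> s p) (differential A A (\<phi> s) p v) (differential A A (\<phi> s) p w) = g p v w"
proof -
  have mf: "smooth_manifold T A" using N by (simp add: riemannian_manifold_def)
  have \<phi>: "smooth_real_action T A \<phi>" using flow by (simp add: flow_of_def)
  define n where "n = chart_at A p"
  have n: "n \<in> A" "p \<in> fst n" using chart_at_props[OF mf p] by (auto simp: n_def)
  have nn: "is_chart T n" using mf n by (simp add: smooth_manifold_chart)
  define a where "a = v n" define b where "b = w n"
  have v: "v = coord_vec A n p a" and w: "w = coord_vec A n p b"
    unfolding a_def b_def using tangent_space_coord_vec[OF mf n] v w by auto
  define H where "H s = g (\<phi> s p) (differential A A (\<phi> s) p v) (differential A A (\<phi> s) p w)" for s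
  have "(H has_real_derivative 0) (at s)" for s
  proof -
    \<comment> \<open>A new target chart is chosen for every time, since the orbit may leave any
      single chart; the chart \<open>n\<close> of the initial point stays fixed.\<close>
    define k where "k = chart_at A (\<phi> s p)"
    have k: "k \<in> A" "\<phi> s p \<in> fst k" using chart_at_props[OF mf action_topspace[OF \<phi> p]] by (auto simp: k_def)
    let ?W = "action_domain \<phi> n k" and ?Y = "action_rep \<phi> n k"
    have mem: "(s, snd n p) \<in> ?W \<longleftrightarrow> \<phi> s p \<in> fst k" for s
      using n chart_inverse[OF nn] by (auto simp: action_domain_def)
    let ?U = "(\<lambda>s. (s, snd n p)) -` ?W"
    have U: "open ?U"
      by (intro continuous_open_vimage action_domain_open[OF mf \<phi> n(1) k(1)]) (auto intro!: continuous_intros)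
    have "metric_quad (metric_comp A g k (?Y (r, snd n p))) (frechet_derivative ?Y (at (r, snd n p)) (0, a))
        (frechet_derivative ?Y (at (r, snd n p)) (0, b)) = H r" if "r \<in> ?U" for r
    proof -
      have r: "(r, snd n p) \<in> ?W" "\<phi> r p \<in> fst k" using that mem by auto
      have Y: "?Y differentiable (at (r, snd n p))"
        by (rule smooth_on_differentiable[OF action_rep_smooth[OF \<phi> n(1) k(1)] r(1)])
      have "?Y (r, snd n p) = snd k (\<phi> r p)" by (simp add: action_rep_def chart_inverse[OF nn n(2)])
      then show ?thesis
        unfolding H_def v w differential_coord_vec[OF action_manifold_map[OF mf \<phi>] n(1) k(1) n(2) r(2)]
          local_rep_action_frechet[OF Y] riemannian_metric_coord_vec[OF N k(1) r(2)] by simp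
    qed
    moreover have "s \<in> ?U" using mem k by simp
    moreover have "((\<lambda>s. metric_quad (metric_comp A g k (?Y (s, snd n p))) (frechet_derivative ?Y (at (s, snd n p)) (0, a))
        (frechet_derivative ?Y (at (s, snd n p)) (0, b))) has_real_derivative 0) (at s)"
      by (rule killing_flow_metric_derivative[OF N X flow n(1) k(1)]) (use mem k in simp)
    ultimately show ?thesis
      using has_field_derivative_transform_within_open[OF _ U] by blast
  qed
  then have "H s = H 0" using DERIV_isconst_all by blast
  moreover have "H 0 = g p v w"
  proof -
    have 0: "\<phi> 0 q = q" if "q \<in> topspace T" for q using \<phi> that by (simp add: smooth_real_action_def)
    have "frechet_derivative (local_rep (\<phi> 0) n n) (at (snd n p)) = frechet_derivative (\<lambda>z. z) (at (snd n p))"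
    proof (rule frechet_derivative_cong_open)
      show "open (snd n ` fst n)" using nn by (simp add: is_chart_def)
      show "local_rep (\<phi> 0) n n w = w" if "w \<in> snd n ` fst n" for w
        using that chart_inverse[OF nn] chart_subset_topspace[OF nn] by (auto simp: local_rep_def 0 subset_iff)
    qed (use n in auto)
    then have "differential A A (\<phi> 0) p (coord_vec A n p c) = coord_vec A n p c" for c
      using differential_coord_vec[OF action_manifold_map[OF mf \<phi>] n(1) n(1) n(2), of 0 c] n 0[OF p] by simp
    then show ?thesis by (simp add: H_def v w 0[OF p])
  qed
  ultimately show ?thesis by (simp add: H_def)
qed

section \<open>Surfaces with an invariant metric\<close>

text \<open>The form with coefficient \<open>\<beta> (U w)\<close> times the differential of
  \<open>U\<close> is closed: differentiating the coefficient contributes the product of two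
  derivatives of \<open>U\<close>, symmetric in the directions, and the rest is a second derivative
  of \<open>U\<close>.\<close>

lemma frechet_derivative_compose_mult_symmetric:
  fixes U :: "'a::euclidean_space \<Rightarrow> real" and \<beta> :: "real \<Rightarrow> real"
  assumes S: "open S" "z \<in> S" and U: "Ck_on (Suc (Suc 0)) S U" and \<beta>: "\<beta> differentiable (at (U z))"
  shows "(\<lambda>w. \<beta> (U w) * frechet_derivative U (at w) a) differentiable (at z)"
    "frechet_derivative (\<lambda>w. \<beta> (U w) * frechet_derivative U (at w) a) (at z) b =
     frechet_derivative (\<lambda>w. \<beta> (U w) * frechet_derivative U (at w) b) (at z) a"
proof -
  have dU: "U differentiable (at z)" and ddU: "(\<lambda>w. frechet_derivative U (at w) c) differentiable (at z)" for c
    using U S by auto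
  have lin: "frechet_derivative \<beta> (at (U z)) x = x * frechet_derivative \<beta> (at (U z)) 1" for x
    using linear_scale[OF linear_frechet_derivative[OF \<beta>], of x 1] by simp
  have D: "((\<lambda>w. \<beta> (U w) * frechet_derivative U (at w) a) has_derivative
    (\<lambda>b. \<beta> (U z) * frechet_derivative (\<lambda>w. frechet_derivative U (at w) a) (at z) b +
      frechet_derivative \<beta> (at (U z)) (frechet_derivative U (at z) b) * frechet_derivative U (at z) a)) (at z)" for a
    by (intro has_derivative_mult has_derivative_compose[of U _ _ UNIV \<beta>] differentiable_has_frechet dU ddU \<beta>)
  show "(\<lambda>w. \<beta> (U w) * frechet_derivative U (at w) a) differentiable (at z)"
    using D by (auto simp: differentiable_def)
  show "frechet_derivative (\<lambda>w. \<beta> (U w) * frechet_derivative U (at w) a) (at z) b =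
     frechet_derivative (\<lambda>w. \<beta> (U w) * frechet_derivative U (at w) b) (at z) a"
    unfolding frechet_derivative_eqI[OF D] lin[of "frechet_derivative U (at z) a"] lin[of "frechet_derivative U (at z) b"]
    by (simp add: second_derivative_symmetric[OF U S, of a b] mult_ac)
qed

text \<open>A metric \<open>E(u) du\<^sup>2 + 2 F(u) du dv + G\<^sub>0 dv\<^sup>2\<close> with constant \<open>G\<^sub>0\<close> has the closed orthonormal coframe
  \<open>(E - F\<^sup>2/G\<^sub>0)\<^sup>1\<^sup>/\<^sup>2 du\<close>, \<open>F/\<surd>G\<^sub>0 du + \<surd>G\<^sub>0 dv\<close>, which is pulled back by \<open>Z = (u, v)\<close>.\<close>

lemma gauss_curvature_pullback_zero:
  fixes Z :: "real^2 \<Rightarrow> real^2" and E F :: "real \<Rightarrow> real" and h :: "real^2 \<Rightarrow> real^2^2"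
  assumes S: "open S" "z\<^sub>0 \<in> S" and B: "open B" "\<And>z. z \<in> S \<Longrightarrow> Z z $ 1 \<in> B"
    and Z: "smooth_on S Z" and E: "smooth_on B E" and F: "smooth_on B F"
    and G0: "G\<^sub>0 > 0" and pos: "\<And>r. r \<in> B \<Longrightarrow> E r * G\<^sub>0 - F r * F r > 0"
    and h: "\<And>z i j. z \<in> S \<Longrightarrow> h z $ i $ j =
      (let p = frechet_derivative Z (at z) (axis i 1); q = frechet_derivative Z (at z) (axis j 1)
       in E (Z z $ 1) * p $ 1 * q $ 1 + F (Z z $ 1) * (p $ 1 * q $ 2 + p $ 2 * q $ 1) + G\<^sub>0 * p $ 2 * q $ 2)"
    and det: "\<And>z. z \<in> S \<Longrightarrow> det (h z) \<noteq> 0"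
  shows "gauss_curvature_coord h z\<^sub>0 = 0"
proof -
  define U where "U z = Z z $ 1" for z
  define V where "V z = Z z $ 2" for z
  define m where "m r = ((E r * G\<^sub>0 - F r * F r) * (1 / G\<^sub>0)) powr (1/2)" for r
  define n where "n r = F r * (1 / sqrt G\<^sub>0)" for r
  \<comment> \<open>The two components are the values of the two pulled back forms of the coframe on
    the i-th coordinate vector.\<close>
  define P where "P i z = (m (U z) * frechet_derivative U (at z) (axis i 1)) *\<^sub>R axis 1 1
    + (n (U z) * frechet_derivative U (at z) (axis i 1) + sqrt G\<^sub>0 * frechet_derivative V (at z) (axis i 1)) *\<^sub>R (axis 2 1 :: real^2)"
    for i :: 2 and z
  have CU: "Ck_on k S U" and CV: "Ck_on k S V" for k
    unfolding U_def[abs_def] V_def[abs_def] by (intro Ck_on_nth S smooth_on_imp_Ck Z)+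
  have Cn: "Ck_on k B n" for k
    unfolding n_def[abs_def] by (intro Ck_on_mult B Ck_on_const smooth_on_imp_Ck F)
  have Cm: "Ck_on k B m" for k
    unfolding m_def[abs_def]
  proof (rule Ck_on_compose[OF B(1) open_greaterThan _ _ Ck_on_powr])
    show "Ck_on k B (\<lambda>r. (E r * G\<^sub>0 - F r * F r) * (1 / G\<^sub>0))"
      using Ck_on_mult[OF B(1) Ck_on_add[OF B(1) Ck_on_mult[OF B(1) smooth_on_imp_Ck[OF E] Ck_on_const[of _ _ G\<^sub>0]]
        Ck_on_mult[OF B(1) Ck_on_const[of _ _ "-1"] Ck_on_mult[OF B(1) smooth_on_imp_Ck[OF F] smooth_on_imp_Ck[OF F]]]]
        Ck_on_const[of _ _ "1 / G\<^sub>0"]] by simp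
  qed (use pos G0 in auto)
  have UB: "U z \<in> B" if "z \<in> S" for z using B(2)[OF that] by (simp add: U_def)
  have dm: "m differentiable (at (U z))" and dn: "n differentiable (at (U z))" if "z \<in> S" for z
    using Cm[of 1] Cn[of 1] UB[OF that] by auto
  have dU: "frechet_derivative U (at z) a = frechet_derivative Z (at z) a $ 1"
    and dV: "frechet_derivative V (at z) a = frechet_derivative Z (at z) a $ 2" if "z \<in> S" for z a
    unfolding U_def[abs_def] V_def[abs_def]
    using frechet_linear_comp[OF bounded_linear_vec_nth smooth_on_differentiable[OF Z that]] by metis+
  show ?thesis
  proof (rule gauss_curvature_coframe_zero[OF S])
    show "Ck_on (Suc (Suc 0)) S (P i)" for i
      unfolding P_def[abs_def]
      by (intro Ck_on_add Ck_on_scaleR Ck_on_mult Ck_on_const S Ck_on_SucD[OF CU] Ck_on_SucD[OF CV]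
          Ck_on_compose[OF S(1) B(1) UB CU Cm] Ck_on_compose[OF S(1) B(1) UB CU Cn])
    show "det (h w) \<noteq> 0" if "w \<in> S" for w using det[OF that] .
    show "h w $ i $ j = P i w \<bullet> P j w" if w: "w \<in> S" for w i j
    proof -
      have m2: "m (U w) * m (U w) = (E (U w) * G\<^sub>0 - F (U w) * F (U w)) / G\<^sub>0"
        using pos[OF UB[OF w]] G0 by (simp add: m_def powr_half_sqrt)
      have n1: "n (U w) * sqrt G\<^sub>0 = F (U w)" and n2: "n (U w) * n (U w) = F (U w) * F (U w) / G\<^sub>0"
        using G0 by (simp_all add: n_def)
      have mn: "m (U w) * m (U w) + n (U w) * n (U w) = E (U w)"
        unfolding m2 n2 using G0 by (simp add: field_simps)
      have s: "sqrt G\<^sub>0 * sqrt G\<^sub>0 = G\<^sub>0" using G0 by simp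
      \<comment> \<open>With \<open>M\<close> and \<open>N\<close> the values of \<open>m\<close>
        and \<open>n\<close> and \<open>s\<close> the root of \<open>G\<^sub>0\<close>, the
        coefficients on the left are \<open>E\<close>, \<open>F\<close> and
        \<open>G\<^sub>0\<close>; the right side is the inner product of coframe values.\<close>
      have alg: "(M * M + N * N) * p1 * q1 + N * s * (p1 * q2 + p2 * q1) + s * s * p2 * q2 =
        (M * p1) * (M * q1) + (N * p1 + s * p2) * (N * q1 + s * q2)" for M N s p1 p2 q1 q2 :: real
        by (simp add: algebra_simps)
      show ?thesis
        using alg[of "m (U w)" "n (U w)" _ _ "sqrt G\<^sub>0"]
        unfolding h[OF w] Let_def mn n1 s
        by (simp add: P_def inner_vec_def sum_2 axis_def dU[OF w] dV[OF w] U_def)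
    qed
    show "frechet_derivative (P i) (at w) (axis j 1) = frechet_derivative (P j) (at w) (axis i 1)"
      if w: "w \<in> S" for w i j
    proof -
      note mU = frechet_derivative_compose_mult_symmetric[OF S(1) w CU dm[OF w]]
      note nU = frechet_derivative_compose_mult_symmetric[OF S(1) w CU dn[OF w]]
      \<comment> \<open>The second form contains a constant multiple of the differential of
        \<open>V\<close>, covered by taking a constant coefficient.\<close>
      note sV = frechet_derivative_compose_mult_symmetric[OF S(1) w CV differentiable_const[of "sqrt G\<^sub>0"]]
      have "frechet_derivative (P i) (at w) = (\<lambda>b.
        frechet_derivative (\<lambda>z. m (U z) * frechet_derivative U (at z) (axis i 1)) (at w) b *\<^sub>R axis 1 1
        + (frechet_derivative (\<lambda>z. n (U z) * frechet_derivative U (at z) (axis i 1)) (at w) b +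
         frechet_derivative (\<lambda>z. sqrt G\<^sub>0 * frechet_derivative V (at z) (axis i 1)) (at w) b) *\<^sub>R axis 2 1)" for i
        unfolding P_def[abs_def]
        by (intro frechet_derivative_eqI has_derivative_add has_derivative_scaleR_left
            differentiable_has_frechet mU(1) nU(1) sV(1))
      then show ?thesis by (simp only: mU(2)[of "axis i 1" "axis j 1"] nU(2)[of "axis i 1" "axis j 1"] sV(2)[of "axis i 1" "axis j 1"])
    qed
  qed
qed

text \<open>The metric does not depend on the second coordinate, so the second coordinate field is
  Killing. In the derivative of its product with the velocity, the change of the metric along the
  curve cancels against the acceleration prescribed by the geodesic equation.\<close>

lemma clairaut:
  fixes h :: "real^2 \<Rightarrow> real^2^2" and y :: "real \<Rightarrow> real^2"
  defines "y' \<equiv> \<lambda>t. vector_derivative y (at t)"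
  assumes h: "\<And>i j. (\<lambda>z. h z $ i $ j) differentiable (at (y s))"
    and sym: "\<And>i j. h (y s) $ i $ j = h (y s) $ j $ i" and det: "det (h (y s)) \<noteq> 0"
    and inv: "\<And>i j. partial 2 (\<lambda>z. h z $ i $ j) (y s) = 0"
    and y: "y differentiable (at s)" "y' differentiable (at s)"
    and geod: "\<And>k. vector_derivative y' (at s) $ k +
       (\<Sum>i\<in>UNIV. \<Sum>j\<in>UNIV. christoffel h (y s) k i j * y' s $ i * y' s $ j) = 0"
  shows "((\<lambda>s. metric_quad (h (y s)) (y' s) (axis 2 1)) has_real_derivative 0) (at s)"
proof -
  have dy: "(y has_vector_derivative y' s) (at s)" using y(1) by (simp add: y'_def vector_derivative_works)
  have dy': "(y' has_vector_derivative vector_derivative y' (at s)) (at s)" using y(2) by (simp add: vector_derivative_works)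
  define G' :: "real^2^2" where "G' = (\<chi> i j. \<Sum>l\<in>UNIV. y' s $ l * partial l (\<lambda>z. h z $ i $ j) (y s))"
  have G': "((\<lambda>s. h (y s) $ i $ j) has_real_derivative G' $ i $ j) (at s)" for i j
  proof -
    have "((\<lambda>s. h (y s) $ i $ j) has_derivative (\<lambda>x. frechet_derivative (\<lambda>z. h z $ i $ j) (at (y s)) (x *\<^sub>R y' s))) (at s)"
      by (rule has_derivative_compose[where g = "\<lambda>z. h z $ i $ j"])
        (use dy in \<open>auto simp: has_vector_derivative_def intro: differentiable_has_frechet h\<close>)
    then have "((\<lambda>s. h (y s) $ i $ j) has_vector_derivative frechet_derivative (\<lambda>z. h z $ i $ j) (at (y s)) (y' s)) (at s)"
      by (simp add: has_vector_derivative_def linear_scale[OF linear_frechet_derivative[OF h]])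
    then show ?thesis
      unfolding frechet_derivative_expansion[OF h, of _ _ "y' s"]
      by (simp add: G'_def partial_def has_real_derivative_iff_has_vector_derivative)
  qed
  have D: "((\<lambda>s. metric_quad (h (y s)) (y' s) (axis 2 1)) has_real_derivative
     metric_quad G' (y' s) (axis 2 1) + metric_quad (h (y s)) (vector_derivative y' (at s)) (axis 2 1)
      + metric_quad (h (y s)) (y' s) 0) (at s)"
    by (rule metric_quad_has_derivative[OF G' dy']) (rule has_vector_derivative_const)
  have hinv: "h (y s) ** matrix_inv (h (y s)) = mat 1"
    using det by (rule matrix_inv_right)
  have e2: "metric_quad H a (axis 2 1) = (\<Sum>k\<in>UNIV. H $ k $ 2 * a $ k)" for H :: "real^2^2" and a
    by (simp add: metric_quad_def sum_2 axis_def)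
  \<comment> \<open>Christoffel symbols of the first kind; contraction with the metric undoes the
    inverse matrix, so the acceleration term needs only \<open>L i j 2\<close>.\<close>
  define L where "L i j l = (partial i (\<lambda>w. h w $ j $ l) (y s) + partial j (\<lambda>w. h w $ i $ l) (y s)
    - partial l (\<lambda>w. h w $ i $ j) (y s)) / 2" for i j l
  have lower: "(\<Sum>k\<in>UNIV. h (y s) $ k $ 2 * christoffel h (y s) k i j) = L i j 2" for i j
  proof -
    have "(\<Sum>k\<in>UNIV. h (y s) $ k $ 2 * christoffel h (y s) k i j) =
      (\<Sum>k\<in>UNIV. \<Sum>l\<in>UNIV. h (y s) $ 2 $ k * matrix_inv (h (y s)) $ k $ l * L i j l)"
      by (simp add: christoffel_def sum_distrib_left L_def sym[of _ 2] mult_ac)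
    also have "\<dots> = (\<Sum>l\<in>UNIV. (h (y s) ** matrix_inv (h (y s))) $ 2 $ l * L i j l)"
      by (subst sum.swap) (simp add: matrix_matrix_mult_def sum_distrib_right)
    also have "\<dots> = L i j 2" unfolding hinv by (simp add: mat_def sum_2)
    finally show ?thesis .
  qed
  have "metric_quad (h (y s)) (vector_derivative y' (at s)) (axis 2 1) =
    - (\<Sum>k\<in>UNIV. \<Sum>i\<in>UNIV. \<Sum>j\<in>UNIV. h (y s) $ k $ 2 * christoffel h (y s) k i j * (y' s $ i * y' s $ j))"
  proof -
    have acc: "vector_derivative y' (at s) $ k = - (\<Sum>i\<in>UNIV. \<Sum>j\<in>UNIV. christoffel h (y s) k i j * y' s $ i * y' s $ j)" for k
      using geod[of k] by linarith
    show ?thesis unfolding e2 acc by (simp add: sum_2 algebra_simps)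
  qed
  also have "\<dots> = - (\<Sum>i\<in>UNIV. \<Sum>j\<in>UNIV. (\<Sum>k\<in>UNIV. h (y s) $ k $ 2 * christoffel h (y s) k i j) * (y' s $ i * y' s $ j))"
    by (simp add: sum_2 algebra_simps)
  also have "\<dots> = - (\<Sum>i\<in>UNIV. \<Sum>j\<in>UNIV. L i j 2 * (y' s $ i * y' s $ j))" by (simp only: lower)
  \<comment> \<open>By \<open>inv\<close> the derivative in direction 2 drops out of
    \<open>L i j 2\<close>, and the two remaining halves become equal when summed against the
    velocity twice.\<close>
  also have "\<dots> = - metric_quad G' (y' s) (axis 2 1)"
    unfolding e2 by (simp add: sum_2 L_def G'_def inv field_simps)
  finally show ?thesis using D by (simp add: metric_quad_def)
qed

text \<open>A nonzero derivative yields values on both sides of \<open>f s\<close>, and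
  connectedness of \<open>J\<close> yields all values between them. Only an interval of attained
  values is sought, not a local inverse.\<close>

lemma derivative_nonzero_image_nhd:
  fixes f :: "real \<Rightarrow> real"
  assumes J: "open J" "connected J" "s \<in> J" and f: "continuous_on J f"
    and d: "(f has_real_derivative l) (at s)" "l \<noteq> 0"
  shows "\<exists>a b. a < f s \<and> f s < b \<and> {a<..<b} \<subseteq> f ` J"
proof -
  obtain e where e: "e > 0" "\<And>t. dist t s < e \<Longrightarrow> t \<in> J" using J by (auto simp: open_dist)
  have "\<exists>s1\<in>J. \<exists>s2\<in>J. f s1 < f s \<and> f s < f s2"
  proof (cases "l > 0")
    case True
    obtain d1 where d1: "d1 > 0" "\<And>h. 0 < h \<Longrightarrow> h < d1 \<Longrightarrow> f s < f (s + h)"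
      using DERIV_pos_inc_right[OF d(1) True] by auto
    obtain d2 where d2: "d2 > 0" "\<And>h. 0 < h \<Longrightarrow> h < d2 \<Longrightarrow> f (s - h) < f s"
      using DERIV_pos_inc_left[OF d(1) True] by auto
    define t where "t = min e (min d1 d2) / 2"
    have "t > 0" "t < e" "t < d1" "t < d2" using e d1 d2 by (auto simp: t_def min_def)
    then show ?thesis using e(2)[of "s + t"] e(2)[of "s - t"] d1(2)[of t] d2(2)[of t]
      by (auto simp: dist_real_def)
  next
    case False
    then have l: "l < 0" using d(2) by simp
    obtain d1 where d1: "d1 > 0" "\<And>h. 0 < h \<Longrightarrow> h < d1 \<Longrightarrow> f s > f (s + h)"
      using DERIV_neg_dec_right[OF d(1) l] by auto
    obtain d2 where d2: "d2 > 0" "\<And>h. 0 < h \<Longrightarrow> h < d2 \<Longrightarrow> f (s - h) > f s"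
      using DERIV_neg_dec_left[OF d(1) l] by auto
    define t where "t = min e (min d1 d2) / 2"
    have "t > 0" "t < e" "t < d1" "t < d2" using e d1 d2 by (auto simp: t_def min_def)
    then show ?thesis using e(2)[of "s + t"] e(2)[of "s - t"] d1(2)[of t] d2(2)[of t]
      by (auto simp: dist_real_def)
  qed
  then obtain s1 s2 where s: "s1 \<in> J" "s2 \<in> J" "f s1 < f s" "f s < f s2" by blast
  have "{f s1..f s2} \<subseteq> f ` J"
    by (rule connected_contains_Icc[OF connected_continuous_image[OF f J(2)]]) (use s in auto)
  then show ?thesis using s by (intro exI[of _ "f s1"] exI[of _ "f s2"]) auto
qed

section \<open>Immersions equivariant under a Killing flow\<close>

lemma bilinear_metric_quad: "bilinear (metric_quad H)"
  unfolding bilinear_def metric_quad_def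
  by (auto intro!: linearI simp: algebra_simps sum.distrib sum_distrib_left)

lemma smooth_on_metric_quad:
  assumes S: "open S" and G: "\<And>i j. smooth_on S (\<lambda>z. G z $ i $ j)" and "smooth_on S A" "smooth_on S B"
  shows "smooth_on S (\<lambda>z. metric_quad (G z) (A z) (B z))"
  unfolding metric_quad_def smooth_on_def
  by (intro allI Ck_on_sum Ck_on_mult Ck_on_nth smooth_on_imp_Ck assms)

locale immersed_in_killing_manifold =
  fixes TN :: "'n topology" and AN :: "('n, 'd::finite) chart set" and g :: "('n, 'd) metric_tensor"
    and X :: "('n, 'd) vfield" and \<phi> :: "real \<Rightarrow> 'n \<Rightarrow> 'n"
    and TM :: "'m topology" and AM :: "('m, 2) chart set" and f :: "'m \<Rightarrow> 'n"
  assumes N: "riemannian_manifold TN AN g"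
    and X: "killing_field TN AN g X"
    and flow: "flow_of TN AN X \<phi>"
    and M: "smooth_manifold TM AM"
    and imm: "immersion TM AM TN AN f"
begin

abbreviation "hM \<equiv> induced_metric AM AN f g"
abbreviation "h c \<equiv> metric_comp AM hM c"

lemma N_manifold: "smooth_manifold TN AN"
  using N by (simp add: riemannian_manifold_def)

lemma action: "smooth_real_action TN AN \<phi>"
  using flow by (simp add: flow_of_def)

lemma f_map: "manifold_map TM AM TN AN f"
  using M N_manifold imm by (simp add: manifold_map_def immersion_def)

lemma in_topspace: "c \<in> AM \<Longrightarrow> p \<in> fst c \<Longrightarrow> p \<in> topspace TM"
  using chart_subset_topspace[OF smooth_manifold_chart[OF M], of c] by blast

lemma f_topspace: "c \<in> AM \<Longrightarrow> p \<in> fst c \<Longrightarrow> f p \<in> topspace TN"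
  by (rule manifold_map_topspace[OF f_map in_topspace])

section \<open>The induced metric in the charts of the surface\<close>

lemma induced_metric_local:
  assumes "c \<in> AM" "p \<in> fst c" "d \<in> AN" "f p \<in> fst d"
  shows "hM p (coord_vec AM c p a) (coord_vec AM c p b) =
    metric_quad (metric_comp AN g d (snd d (f p))) (frechet_derivative (local_rep f c d) (at (snd c p)) a)
      (frechet_derivative (local_rep f c d) (at (snd c p)) b)"
  by (simp only: induced_metric_def differential_coord_vec[OF f_map assms(1,3,2,4)]
      riemannian_metric_coord_vec[OF N assms(3,4)])

lemma induced_metric_coord_vec:
  assumes c: "c \<in> AM" "p \<in> fst c"
  shows "hM p (coord_vec AM c p a) (coord_vec AM c p b) = metric_quad (h c (snd c p)) a b"
proof (rule metric_coord_vec[OF smooth_manifold_chart[OF M c(1)] c(2)])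
  define d where "d = chart_at AN (f p)"
  have d: "d \<in> AN" "f p \<in> fst d" using chart_at_props[OF N_manifold f_topspace[OF c]] by (auto simp: d_def)
  let ?D = "frechet_derivative (local_rep f c d) (at (snd c p))"
  have l: "linear ?D" by (intro linear_frechet_derivative local_rep_differentiable[OF f_map] c d)
  note B = bilinear_metric_quad[of "metric_comp AN g d (snd d (f p))"]
  show "bilinear (\<lambda>a b. hM p (coord_vec AM c p a) (coord_vec AM c p b))"
    unfolding induced_metric_local[OF c d] bilinear_def
    by (auto intro!: linearI simp: linear_add[OF l] linear_scale[OF l] bilinear_ladd[OF B] bilinear_radd[OF B]
        bilinear_lmul[OF B] bilinear_rmul[OF B])
qed

lemma chart_image_cases:
  assumes "c \<in> AM" "z \<in> snd c ` fst c"
  obtains p where "p \<in> fst c" "z = snd c p" "inv_into (fst c) (snd c) z = p"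
  using assms chart_inverse[OF smooth_manifold_chart[OF M]] by auto

text \<open>The image under \<open>f\<close> of the domain of \<open>c\<close> may spread over many
  ambient charts. Near each point a single chart \<open>d\<close> suffices, where the entries are
  sums of products of ambient metric components and first derivatives of the representation of
  \<open>f\<close>.\<close>

lemma metric_smooth:
  assumes c: "c \<in> AM"
  shows "smooth_on (snd c ` fst c) (\<lambda>z. h c z $ i $ j)"
proof (rule smooth_on_local)
  fix z assume "z \<in> snd c ` fst c"
  then obtain p where p: "p \<in> fst c" "z = snd c p" by auto
  define d where "d = chart_at AN (f p)"
  have d: "d \<in> AN" "f p \<in> fst d" using chart_at_props[OF N_manifold f_topspace[OF c p(1)]] by (auto simp: d_def)
  have cc: "is_chart TM c" and dd: "is_chart TN d"
    using M N_manifold c d by (auto simp: smooth_manifold_chart)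
  let ?T = "rep_domain f c d" and ?F = "local_rep f c d"
  have T: "open ?T" by (rule rep_domain_open[OF f_map c d(1)])
  have F: "smooth_on ?T ?F" by (rule local_rep_smooth[OF f_map c d(1)])
  have eq: "metric_quad (metric_comp AN g d (?F w)) (frechet_derivative ?F (at w) (axis i 1))
      (frechet_derivative ?F (at w) (axis j 1)) = h c w $ i $ j" if w: "w \<in> ?T" for w
  proof -
    note q = rep_domainD[OF cc w]
    show ?thesis
      using induced_metric_coord_vec[OF c q(1), of "axis i 1" "axis j 1"]
        induced_metric_local[OF c q(1) d(1) q(2), of "axis i 1" "axis j 1"]
      by (simp add: q local_rep_def)
  qed
  have G: "smooth_on ?T (\<lambda>w. metric_comp AN g d (?F w) $ k $ l)" for k l
  proof -
    have G0: "smooth_on (snd d ` fst d) (metric_comp AN g d)"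
      using N d by (auto simp: riemannian_manifold_def riemannian_metric_def)
    have "smooth_on ?T (\<lambda>w. metric_comp AN g d (?F w))"
    proof (rule smooth_on_compose[OF T _ _ F G0])
      show "open (snd d ` fst d)" using dd by (simp add: is_chart_def)
      show "?F w \<in> snd d ` fst d" if "w \<in> ?T" for w
        unfolding local_rep_def comp_apply by (rule imageI) (rule rep_domainD(2)[OF cc that])
    qed
    then show ?thesis unfolding smooth_on_def by (intro allI Ck_on_nth T) auto
  qed
  have "smooth_on ?T (\<lambda>z. h c z $ i $ j)"
    by (rule smooth_on_cong[OF T eq smooth_on_metric_quad[OF T G smooth_on_frechet[OF F] smooth_on_frechet[OF F]]])
  then show "\<exists>T. open T \<and> z \<in> T \<and> smooth_on T (\<lambda>z. h c z $ i $ j)"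
    using T rep_domainI[of p c f d] p d by auto
qed

lemma metric_sym:
  assumes c: "c \<in> AM" and z: "z \<in> snd c ` fst c"
  shows "h c z $ i $ j = h c z $ j $ i"
proof -
  obtain p where p: "p \<in> fst c" "z = snd c p" using z by auto
  define d where "d = chart_at AN (f p)"
  have d: "d \<in> AN" "f p \<in> fst d" using chart_at_props[OF N_manifold f_topspace[OF c p(1)]] by (auto simp: d_def)
  have T: "differential AM AN f p (coord_vec AM c p a) \<in> tangent_space AN (f p)" for a
    unfolding differential_coord_vec[OF f_map c d(1) p(1) d(2)] by (rule coord_vec_in_tangent_space[OF d])
  have "g (f p) v w = g (f p) w v" if "v \<in> tangent_space AN (f p)" "w \<in> tangent_space AN (f p)" for v w
    using N f_topspace[OF c p(1)] that unfolding riemannian_manifold_def riemannian_metric_def by blast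
  then have "hM p (coord_vec AM c p (axis i 1)) (coord_vec AM c p (axis j 1)) =
      hM p (coord_vec AM c p (axis j 1)) (coord_vec AM c p (axis i 1))"
    using T by (simp add: induced_metric_def)
  then show ?thesis by (simp add: induced_metric_coord_vec[OF c p(1)] p)
qed

text \<open>Injectivity of the differential sends a nonzero vector to a nonzero vector, and the
  ambient metric is positive on it.\<close>

lemma metric_pos:
  assumes c: "c \<in> AM" and z: "z \<in> snd c ` fst c" and a: "a \<noteq> 0"
  shows "metric_quad (h c z) a a > 0"
proof -
  obtain p where p: "p \<in> fst c" "z = snd c p" using z by auto
  define d where "d = chart_at AN (f p)"
  have d: "d \<in> AN" "f p \<in> fst d" using chart_at_props[OF N_manifold f_topspace[OF c p(1)]] by (auto simp: d_def)
  let ?F = "frechet_derivative (local_rep f c d) (at (snd c p))"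
  note D = differential_coord_vec[OF f_map c d(1) p(1) d(2)]
  have F0: "?F 0 = 0"
    by (intro linear_0 linear_frechet_derivative local_rep_differentiable[OF f_map] c p d)
  have inj: "inj_on (differential AM AN f p) (tangent_space AM p)"
    using imm in_topspace[OF c p(1)] by (simp add: immersion_def)
  have "differential AM AN f p (coord_vec AM c p a) \<noteq> differential AM AN f p (coord_vec AM c p 0)"
    using inj_on_eq_iff[OF inj coord_vec_in_tangent_space[OF c p(1)] coord_vec_in_tangent_space[OF c p(1)]]
      coord_vec_self[OF M c p(1)] a by metis
  moreover have "differential AM AN f p (coord_vec AM c p 0) = (\<lambda>_. 0)"
    unfolding D F0 using coord_vec_eq_0_iff[OF N_manifold d] by simp
  moreover have "differential AM AN f p (coord_vec AM c p a) \<in> tangent_space AN (f p)"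
    unfolding D by (rule coord_vec_in_tangent_space[OF d])
  ultimately have "hM p (coord_vec AM c p a) (coord_vec AM c p a) > 0"
    using N f_topspace[OF c p(1)] unfolding induced_metric_def riemannian_manifold_def riemannian_metric_def by metis
  then show ?thesis by (simp add: induced_metric_coord_vec[OF c p(1)] p)
qed

lemma metric_22_pos: "c \<in> AM \<Longrightarrow> z \<in> snd c ` fst c \<Longrightarrow> h c z $ 2 $ 2 > 0"
  using metric_pos[of c z "axis 2 1"] by (simp add: axis_eq_0_iff)

lemma metric_minor_pos:
  assumes c: "c \<in> AM" and z: "z \<in> snd c ` fst c"
  shows "h c z $ 1 $ 1 * h c z $ 2 $ 2 - h c z $ 1 $ 2 * h c z $ 1 $ 2 > 0"
proof -
  \<comment> \<open>This vector is orthogonal to the second coordinate vector, and its squared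
    length is \<open>h c z $ 2 $ 2\<close> times the determinant.\<close>
  let ?a = "vector [h c z $ 2 $ 2, - h c z $ 1 $ 2] :: real^2"
  note p = metric_22_pos[OF assms]
  have "?a \<noteq> 0" using p by (metis vector_2(1) zero_index less_irrefl)
  from metric_pos[OF assms this]
  have "h c z $ 2 $ 2 * (h c z $ 1 $ 1 * h c z $ 2 $ 2 - h c z $ 1 $ 2 * h c z $ 1 $ 2) > 0"
    by (simp add: metric_quad_def sum_2 metric_sym[OF assms, of 2 1] algebra_simps)
  then show ?thesis using p by (simp add: zero_less_mult_iff)
qed

lemma metric_det: "c \<in> AM \<Longrightarrow> z \<in> snd c ` fst c \<Longrightarrow> det (h c z) \<noteq> 0"
  using metric_minor_pos[of c z] metric_sym[of c z 2 1] by (simp add: det_2)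

text \<open>The equation \<open>eq\<close> says that \<open>Z\<close> covers the isometry
  \<open>\<phi> t\<close>. With a general \<open>Z\<close> the lemma serves both the shift of the
  second coordinate inside one chart and the action \<open>\<tau>\<close> between two
  charts.\<close>

lemma metric_pullback:
  assumes e: "e \<in> AM" "z\<^sub>0 \<in> snd e ` fst e" and c: "c \<in> AM" "Z z\<^sub>0 \<in> snd c ` fst c"
    and Z: "Z differentiable (at z\<^sub>0)" and V: "open V" "z\<^sub>0 \<in> V"
    and eq: "\<And>z. z \<in> V \<Longrightarrow> f (inv_into (fst c) (snd c) (Z z)) = \<phi> t (f (inv_into (fst e) (snd e) z))"
  shows "metric_quad (h e z\<^sub>0) a b =
    metric_quad (h c (Z z\<^sub>0)) (frechet_derivative Z (at z\<^sub>0) a) (frechet_derivative Z (at z\<^sub>0) b)"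
proof -
  obtain p where p: "p \<in> fst e" "z\<^sub>0 = snd e p" "inv_into (fst e) (snd e) z\<^sub>0 = p" using chart_image_cases[OF e] .
  obtain q where q: "q \<in> fst c" "Z z\<^sub>0 = snd c q" "inv_into (fst c) (snd c) (Z z\<^sub>0) = q" using chart_image_cases[OF c] .
  have fq: "f q = \<phi> t (f p)" using eq[OF V(2)] p q by simp
  note fp = f_topspace[OF e(1) p(1)]
  define n where "n = chart_at AN (f p)"
  have n: "n \<in> AN" "f p \<in> fst n" using chart_at_props[OF N_manifold fp] by (auto simp: n_def)
  define k where "k = chart_at AN (f q)"
  have k: "k \<in> AN" "f q \<in> fst k" using chart_at_props[OF N_manifold f_topspace[OF c(1) q(1)]] by (auto simp: k_def)
  note k' = k(2)[unfolded fq]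
  note \<phi>map = action_manifold_map[OF N_manifold action, of t]
  \<comment> \<open>Both sides are the differential of the same composite, once as
    \<open>\<phi> t\<close> after \<open>f\<close> and once as \<open>f\<close> after
    \<open>Z\<close>, computed in the ambient chart \<open>k\<close>.\<close>
  have D: "differential AN AN (\<phi> t) (f p) (differential AM AN f p (coord_vec AM e p a)) =
      differential AM AN f q (coord_vec AM c q (frechet_derivative Z (at z\<^sub>0) a))" for a
  proof -
    have "differential AN AN (\<phi> t) (f p) (differential AM AN f p (coord_vec AM e p a)) =
      coord_vec AN k (f q) (frechet_derivative (local_rep (\<phi> t \<circ> f) e k) (at (snd e p)) a)"
      unfolding differential_coord_vec[OF f_map e(1) n(1) p(1) n(2)]
        differential_coord_vec[OF \<phi>map n(1) k(1) n(2) k'] fq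
        local_rep_chain[OF f_map \<phi>map e(1) n(1) k(1) p(1) n(2) k'] ..
    also have "frechet_derivative (local_rep (\<phi> t \<circ> f) e k) (at (snd e p)) =
        frechet_derivative (\<lambda>z. local_rep f c k (Z z)) (at (snd e p))"
      by (rule frechet_derivative_cong_open[OF V(1)]) (use V p in \<open>auto simp: local_rep_def eq\<close>)
    also have "\<dots> = (\<lambda>a. frechet_derivative (local_rep f c k) (at (snd c q)) (frechet_derivative Z (at z\<^sub>0) a))"
      unfolding p(2)[symmetric] q(2)[symmetric]
      by (intro frechet_derivative_eqI has_derivative_compose[of Z _ _ UNIV "local_rep f c k"] differentiable_has_frechet Z)
        (use local_rep_differentiable[OF f_map c(1) k(1) q(1) k(2)] q in simp)
    also have "coord_vec AN k (f q) (frechet_derivative (local_rep f c k) (at (snd c q)) (frechet_derivative Z (at z\<^sub>0) a)) =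
        differential AM AN f q (coord_vec AM c q (frechet_derivative Z (at z\<^sub>0) a))"
      by (rule differential_coord_vec[OF f_map c(1) k(1) q(1) k(2), symmetric])
    finally show ?thesis .
  qed
  have T: "differential AM AN f p (coord_vec AM e p a) \<in> tangent_space AN (f p)" for a
    unfolding differential_coord_vec[OF f_map e(1) n(1) p(1) n(2)] by (rule coord_vec_in_tangent_space[OF n])
  have "hM p (coord_vec AM e p a) (coord_vec AM e p b) =
    hM q (coord_vec AM c q (frechet_derivative Z (at z\<^sub>0) a)) (coord_vec AM c q (frechet_derivative Z (at z\<^sub>0) b))"
    unfolding induced_metric_def D[symmetric] fq
    by (rule killing_flow_isometry[OF N X flow fp T T, symmetric])
  then show ?thesis
    unfolding induced_metric_coord_vec[OF e(1) p(1)] induced_metric_coord_vec[OF c(1) q(1)]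
      p(2)[symmetric] q(2)[symmetric] .
qed

section \<open>The chart given by the flow and the profile curve\<close>

lemma invariant_chart_formula:
  assumes psi: "invariant_chart \<phi> AM f I \<epsilon> \<gamma> c" and z: "z \<in> snd c ` fst c"
  shows "f (inv_into (fst c) (snd c) z) = \<phi> (z $ 2) (\<gamma> (z $ 1))"
proof -
  have "c \<in> AM" using psi by (simp add: invariant_chart_def)
  then obtain p where p: "p \<in> fst c" "z = snd c p" "inv_into (fst c) (snd c) z = p"
    using z by (rule chart_image_cases)
  have "f p = \<phi> (snd c p $ 2) (\<gamma> (snd c p $ 1))" using psi p(1) unfolding invariant_chart_def by blast
  then show ?thesis unfolding p(3) by (simp only: p(2))
qed

text \<open>Shifting the second coordinate by \<open>t\<close> covers \<open>\<phi> t\<close>, and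
  the derivative of the shift is the identity, so the pullback compares the metric matrices entry by
  entry.\<close>

lemma invariant_chart_metric:
  assumes psi: "invariant_chart \<phi> AM f I \<epsilon> \<gamma> c" and \<gamma>: "\<gamma> ` I \<subseteq> topspace TN"
    and z: "z \<in> snd c ` fst c" "z' \<in> snd c ` fst c" "z' $ 1 = z $ 1"
  shows "h c z' = h c z"
proof -
  have c: "c \<in> AM" and im: "snd c ` fst c = {z. z $ 1 \<in> I \<and> z $ 2 \<in> {-\<epsilon><..<\<epsilon>}}"
    using psi by (auto simp: invariant_chart_def)
  define t where "t = z' $ 2 - z $ 2"
  define Z where "Z w = w + t *\<^sub>R axis 2 1" for w :: "real^2"
  have Zz: "Z z = z'" using z(3) by (simp add: vec_eq_iff forall_2 Z_def t_def axis_def)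
  have oim: "open (snd c ` fst c)" using smooth_manifold_chart[OF M c] by (simp add: is_chart_def)
  have D: "(Z has_derivative (\<lambda>a. a)) (at w)" for w
    unfolding Z_def by (auto intro!: derivative_eq_intros)
  have cont: "continuous_on UNIV Z" unfolding Z_def[abs_def] by (intro continuous_intros)
  let ?V = "snd c ` fst c \<inter> Z -` (snd c ` fst c)"
  have V: "open ?V" by (intro open_Int oim open_vimage cont)
  have zV: "z \<in> ?V" using z Zz by simp
  have eq: "f (inv_into (fst c) (snd c) (Z w)) = \<phi> t (f (inv_into (fst c) (snd c) w))" if "w \<in> ?V" for w
  proof -
    have w: "w \<in> snd c ` fst c" "Z w \<in> snd c ` fst c" using that by auto
    have "\<gamma> (w $ 1) \<in> topspace TN" using w(1) \<gamma> unfolding im by auto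
    then have "\<phi> (t + w $ 2) (\<gamma> (w $ 1)) = \<phi> t (\<phi> (w $ 2) (\<gamma> (w $ 1)))"
      using action by (simp add: smooth_real_action_def)
    then show ?thesis
      unfolding invariant_chart_formula[OF psi w(1)] invariant_chart_formula[OF psi w(2)]
      by (simp add: Z_def axis_def add.commute)
  qed
  have "metric_quad (h c z) a b = metric_quad (h c z') a b" for a b
    using metric_pullback[OF c z(1) c, of Z ?V t a b] z(2) V zV eq
    by (simp add: Zz frechet_derivative_eqI[OF D] differentiable_def) (use D in blast)
  from this[of "axis i 1" "axis j 1" for i j] show ?thesis by (simp add: vec_eq_iff)
qed

lemma invariant_chart_partial:
  assumes psi: "invariant_chart \<phi> AM f I \<epsilon> \<gamma> c" and \<gamma>: "\<gamma> ` I \<subseteq> topspace TN"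
    and z: "z \<in> snd c ` fst c"
  shows "partial 2 (\<lambda>z. h c z $ i $ j) z = 0"
proof -
  have c: "c \<in> AM" using psi by (simp add: invariant_chart_def)
  have oim: "open (snd c ` fst c)" using smooth_manifold_chart[OF M c] by (simp add: is_chart_def)
  let ?F = "\<lambda>z. h c z $ i $ j"
  have d: "?F differentiable (at (z + 0 *\<^sub>R axis 2 1))"
    using smooth_on_differentiable[OF metric_smooth[OF c] z] by simp
  have "((\<lambda>x. ?F (z + x *\<^sub>R axis 2 1)) has_vector_derivative partial 2 ?F z) (at 0)"
    using has_derivative_line[OF d] by (simp add: partial_def)
  then have "((\<lambda>x. ?F z) has_vector_derivative partial 2 ?F z) (at 0)"
  proof (rule has_vector_derivative_transform_within_open)
    let ?V = "(\<lambda>x. z + x *\<^sub>R axis 2 1) -` (snd c ` fst c)"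
    show "open ?V" by (intro open_vimage oim continuous_intros)
    show "0 \<in> ?V" using z by simp
    show "?F (z + x *\<^sub>R axis 2 1) = ?F z" if "x \<in> ?V" for x
      using invariant_chart_metric[OF psi \<gamma> z, of "z + x *\<^sub>R axis 2 1"] that by (simp add: axis_def)
  qed
  then show ?thesis
    by (rule vector_derivative_unique_at[OF _ has_vector_derivative_const])
qed

text \<open>Along the second coordinate \<open>f\<close> traces the flow line of the point
  \<open>\<gamma> (z $ 1)\<close>, whose velocity is \<open>X\<close>.\<close>

lemma invariant_chart_killing:
  assumes psi: "invariant_chart \<phi> AM f I \<epsilon> \<gamma> c" and \<gamma>: "\<gamma> ` I \<subseteq> topspace TN" and p: "p \<in> fst c"
  shows "differential AM AN f p (coord_vec AM c p (axis 2 1)) = X (f p)"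
proof -
  have c: "c \<in> AM" and im: "snd c ` fst c = {z. z $ 1 \<in> I \<and> z $ 2 \<in> {-\<epsilon><..<\<epsilon>}}"
    using psi by (auto simp: invariant_chart_def)
  define k where "k = chart_at AN (f p)"
  have k: "k \<in> AN" "f p \<in> fst k" using chart_at_props[OF N_manifold f_topspace[OF c p]] by (auto simp: k_def)
  define z where "z = snd c p"
  have z: "z \<in> snd c ` fst c" using p by (simp add: z_def)
  define q where "q = \<gamma> (z $ 1)"
  have q: "q \<in> topspace TN" using z \<gamma> unfolding im q_def by auto
  have fp: "f p = \<phi> (z $ 2) q"
    using invariant_chart_formula[OF psi z] chart_inverse[OF smooth_manifold_chart[OF M c] p] by (simp add: z_def q_def)
  let ?F = "local_rep f c k"
  have F: "?F differentiable (at (z + 0 *\<^sub>R axis 2 1))"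
    using local_rep_differentiable[OF f_map c k(1) p k(2)] by (simp add: z_def)
  have "((\<lambda>x. ?F (z + x *\<^sub>R axis 2 1)) has_vector_derivative frechet_derivative ?F (at z) (axis 2 1)) (at (z $ 2 - z $ 2))"
    using has_derivative_line[OF F] by simp
  \<comment> \<open>The coordinate line starts at \<open>z\<close> with parameter 0, while the flow
    line reaches the same point at time \<open>z $ 2\<close>; the shift aligns the two
    parameters.\<close>
  moreover have "((\<lambda>r. r - z $ 2) has_real_derivative 1) (at (z $ 2))" by (auto intro!: derivative_eq_intros)
  ultimately have "((\<lambda>x. ?F (z + x *\<^sub>R axis 2 1)) \<circ> (\<lambda>r. r - z $ 2) has_vector_derivative
      1 *\<^sub>R frechet_derivative ?F (at z) (axis 2 1)) (at (z $ 2))"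
    by (intro vector_diff_chain_at) (simp_all add: has_real_derivative_iff_has_vector_derivative)
  then have "(snd k \<circ> (\<lambda>r. \<phi> r q) has_vector_derivative 1 *\<^sub>R frechet_derivative ?F (at z) (axis 2 1)) (at (z $ 2))"
  proof (rule has_vector_derivative_transform_within_open)
    show "open {-\<epsilon><..<\<epsilon>}" by simp
    show "z $ 2 \<in> {-\<epsilon><..<\<epsilon>}" using z unfolding im by simp
    fix r assume r: "r \<in> {-\<epsilon><..<\<epsilon>}"
    have "z + (r - z $ 2) *\<^sub>R axis 2 1 \<in> snd c ` fst c" using r z unfolding im by (simp add: axis_def)
    from invariant_chart_formula[OF psi this]
    show "((\<lambda>x. ?F (z + x *\<^sub>R axis 2 1)) \<circ> (\<lambda>r. r - z $ 2)) r = (snd k \<circ> (\<lambda>r. \<phi> r q)) r"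
      by (simp add: local_rep_def q_def axis_def)
  qed
  then have "vector_derivative (snd k \<circ> (\<lambda>r. \<phi> r q)) (at (z $ 2)) = frechet_derivative ?F (at z) (axis 2 1)"
    by (simp add: vector_derivative_at)
  moreover have "velocity AN (\<lambda>r. \<phi> r q) (z $ 2) = X (f p)"
    using flow q by (simp add: flow_of_def fp)
  then have "velocity AN (\<lambda>r. \<phi> r q) (z $ 2) k = X (f p) k" by (rule fun_cong)
  then have "X (f p) k = vector_derivative (snd k \<circ> (\<lambda>r. \<phi> r q)) (at (z $ 2))"
    using k by (simp add: velocity_def fp)
  ultimately have Xk: "X (f p) k = frechet_derivative ?F (at z) (axis 2 1)" by simp
  have "X (f p) \<in> tangent_space AN (f p)"
    using X f_topspace[OF c p] by (simp add: killing_field_def smooth_vfield_def)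
  from tangent_space_coord_vec[OF N_manifold k this] show ?thesis
    unfolding differential_coord_vec[OF f_map c k(1) p k(2)] Xk z_def by simp
qed

text \<open>The action carries \<open>\<tau> t q\<close> back to \<open>q\<close> by
  \<open>\<tau> (-t)\<close>, which covers an isometry. Its representation \<open>Z\<close> from the
  chart picked at \<open>\<tau> t q\<close> into \<open>c\<close> expresses the metric in the picked
  chart through one that depends on the first coordinate alone.\<close>

lemma gauss_curvature_orbit_zero:
  assumes psi: "invariant_chart \<phi> AM f I \<epsilon> \<gamma> c" and \<gamma>: "\<gamma> ` I \<subseteq> topspace TN" and eps: "\<epsilon> > 0"
    and \<tau>: "smooth_real_action TM AM \<tau>" and equi: "\<And>t x. x \<in> topspace TM \<Longrightarrow> f (\<tau> t x) = \<phi> t (f x)"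
    and const: "\<And>z. z \<in> snd c ` fst c \<Longrightarrow> z $ 1 \<in> {a<..<b} \<Longrightarrow> h c z $ 2 $ 2 = G\<^sub>0"
    and q: "q \<in> fst c" "snd c q $ 1 \<in> {a<..<b}" and ab: "{a<..<b} \<subseteq> I"
  shows "gauss_curvature AM hM (\<tau> t q) = 0"
proof -
  have c: "c \<in> AM" and im: "snd c ` fst c = {z. z $ 1 \<in> I \<and> z $ 2 \<in> {-\<epsilon><..<\<epsilon>}}"
    using psi by (auto simp: invariant_chart_def)
  have cc: "is_chart TM c" by (rule smooth_manifold_chart[OF M c])
  define p where "p = \<tau> t q"
  note qM = in_topspace[OF c q(1)]
  have pM: "p \<in> topspace TM" unfolding p_def by (rule action_topspace[OF \<tau> qM])
  have "\<tau> (-t + t) q = \<tau> (-t) (\<tau> t q)" "\<tau> 0 q = q" using \<tau> qM unfolding smooth_real_action_def by blast+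
  then have undo: "\<tau> (-t) p = q" by (simp add: p_def)
  define e where "e = chart_at AM p"
  have e: "e \<in> AM" "p \<in> fst e" using chart_at_props[OF M pM] by (auto simp: e_def)
  have ee: "is_chart TM e" by (rule smooth_manifold_chart[OF M e(1)])
  note \<tau>map = action_manifold_map[OF M \<tau>, of "-t"]
  let ?D = "rep_domain (\<tau> (-t)) e c"
  define Z where "Z = local_rep (\<tau> (-t)) e c"
  have D: "open ?D" by (rule rep_domain_open[OF \<tau>map e(1) c])
  have Z: "smooth_on ?D Z" unfolding Z_def by (rule local_rep_smooth[OF \<tau>map e(1) c])
  have Zim: "Z z \<in> snd c ` fst c" if "z \<in> ?D" for z
    unfolding Z_def local_rep_def comp_apply by (rule imageI) (rule rep_domainD(2)[OF ee that])
  have Dim: "z \<in> snd e ` fst e" if "z \<in> ?D" for z using that by (auto simp: rep_domain_def)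
  have Zeq: "f (inv_into (fst c) (snd c) (Z z)) = \<phi> (-t) (f (inv_into (fst e) (snd e) z))" if "z \<in> ?D" for z
    using rep_domainD[OF ee that] equi[OF in_topspace[OF e(1)]]
    by (simp add: Z_def local_rep_def chart_inverse[OF cc])
  have pull: "metric_quad (h e z) v w =
      metric_quad (h c (Z z)) (frechet_derivative Z (at z) v) (frechet_derivative Z (at z) w)" if "z \<in> ?D" for z v w
    by (rule metric_pullback[OF e(1) Dim[OF that] c Zim[OF that] smooth_on_differentiable[OF Z that] D that Zeq])
  \<comment> \<open>The line on which the second coordinate is 0, inside the chart since
    \<open>\<epsilon>\<close> is positive. Restriction to it turns the metric entries into smooth
    functions of one real variable.\<close>
  define k :: "real \<Rightarrow> real^2" where "k r = r *\<^sub>R axis 1 1" for r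
  have kim: "k r \<in> snd c ` fst c" if "r \<in> {a<..<b}" for r
    unfolding im using that ab eps by (auto simp: k_def axis_def)
  have hk: "h c (k (z $ 1)) = h c z" if "z \<in> snd c ` fst c" "z $ 1 \<in> {a<..<b}" for z
    by (rule invariant_chart_metric[OF psi \<gamma> that(1) kim[OF that(2)]]) (simp add: k_def axis_def)
  have hk_smooth: "smooth_on {a<..<b} (\<lambda>r. h c (k r) $ i $ j)" for i j
  proof (rule smooth_on_compose[OF open_greaterThanLessThan _ kim _ metric_smooth[OF c]])
    show "open (snd c ` fst c)" using cc by (simp add: is_chart_def)
    have "bounded_linear k" unfolding k_def[abs_def] by (rule bounded_linear_scaleR_left)
    then show "smooth_on {a<..<b} k" unfolding smooth_on_def by (intro allI Ck_on_bounded_linear)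
  qed
  let ?S = "?D \<inter> (\<lambda>z. Z z $ 1) -` {a<..<b}"
  have "continuous_on ?D (\<lambda>z. Z z $ 1)"
    using Ck_on_nth[OF D smooth_on_imp_Ck[OF Z, of 0], of 1] by simp
  then have S: "open ?S" by (intro continuous_open_preimage D open_greaterThanLessThan)
  have val: "Z (snd e p) = snd c q" by (simp add: Z_def local_rep_def chart_inverse[OF ee e(2)] undo)
  have pS: "snd e p \<in> ?S"
    using rep_domainI[of p e "\<tau> (-t)" c] e q val undo by simp
  have "gauss_curvature_coord (h e) (snd e p) = 0"
  proof (rule gauss_curvature_pullback_zero[OF S pS open_greaterThanLessThan _ smooth_on_subset[OF Z] hk_smooth hk_smooth])
    show "G\<^sub>0 > 0" using metric_22_pos[OF c] const[of "snd c q"] q by fastforce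
    show "h c (k r) $ 1 $ 1 * G\<^sub>0 - h c (k r) $ 1 $ 2 * h c (k r) $ 1 $ 2 > 0" if "r \<in> {a<..<b}" for r
      using metric_minor_pos[OF c kim[OF that]] const[OF kim[OF that]] that by (simp add: k_def axis_def)
    show "det (h e z) \<noteq> 0" if "z \<in> ?S" for z using metric_det[OF e(1) Dim] that by simp
    fix z i j assume z: "z \<in> ?S"
    then have zD: "z \<in> ?D" and z1: "Z z $ 1 \<in> {a<..<b}" by auto
    show "h e z $ i $ j =
      (let p = frechet_derivative Z (at z) (axis i 1); q = frechet_derivative Z (at z) (axis j 1)
       in h c (k (Z z $ 1)) $ 1 $ 1 * p $ 1 * q $ 1 + h c (k (Z z $ 1)) $ 1 $ 2 * (p $ 1 * q $ 2 + p $ 2 * q $ 1)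
         + G\<^sub>0 * p $ 2 * q $ 2)"
      using pull[OF zD, of "axis i 1" "axis j 1"]
      by (simp add: metric_quad_def[of "h c (Z z)"] sum_2 Let_def hk[OF Zim[OF zD] z1] const[OF Zim[OF zD] z1]
          metric_sym[OF c Zim[OF zD], of 2 1] algebra_simps)
  qed auto
  then show ?thesis by (simp add: gauss_curvature_def Let_def p_def[symmetric] e_def[symmetric])
qed

text \<open>Clairaut's relation along a loxodrome: the conserved product of the geodesic with the Killing field
  is \<open>\<omega> cos \<theta>\<close>, so \<open>\<omega>\<close> is constant along it.\<close>

lemma geodesic_loxodrome:
  assumes psi: "invariant_chart \<phi> AM f I \<epsilon> \<gamma> c" and \<gamma>: "\<gamma> ` I \<subseteq> topspace TN"
    and J: "open J" "connected J" and \<alpha>c: "\<And>s. s \<in> J \<Longrightarrow> \<alpha> s \<in> fst c"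
    and lox: "loxodrome AN g X TM AM f J \<alpha> \<theta>" and arc: "arclength_parametrized AM hM J \<alpha>"
    and \<theta>: "cos \<theta> \<noteq> 0" "sin \<theta> \<noteq> 0" and geod: "geodesic AM hM J \<alpha>" and s0: "s\<^sub>0 \<in> J"
  defines "y \<equiv> snd c \<circ> \<alpha>"
  shows "\<exists>G\<^sub>0. \<forall>s\<in>J. h c (y s) $ 2 $ 2 = G\<^sub>0"
    and "\<exists>a b. y s\<^sub>0 $ 1 \<in> {a<..<b} \<and> {a<..<b} \<subseteq> (\<lambda>s. y s $ 1) ` J"
proof -
  have c: "c \<in> AM" using psi by (simp add: invariant_chart_def)
  have cc: "is_chart TM c" by (rule smooth_manifold_chart[OF M c])
  define y' where "y' = (\<lambda>t. vector_derivative y (at t))"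
  have yim: "y s \<in> snd c ` fst c" if "s \<in> J" for s using \<alpha>c[OF that] by (simp add: y_def)
  have curve: "smooth_curve TM AM J \<alpha>" using lox by (simp add: loxodrome_def)
  have "{t \<in> J. \<alpha> t \<in> fst c} = J" using \<alpha>c by auto
  then have y: "smooth_on J y" using curve c unfolding smooth_curve_def y_def by metis
  have dy: "y differentiable (at s)" if "s \<in> J" for s by (rule smooth_on_differentiable[OF y that])
  have y'_eq: "frechet_derivative y (at s) 1 = y' s" if "s \<in> J" for s
    by (simp add: frechet_derivative_eq_vector_derivative[OF dy[OF that]] y'_def)
  have dy': "y' differentiable (at s)" if "s \<in> J" for s
    by (rule smooth_on_differentiable[OF smooth_on_cong[OF J(1) y'_eq smooth_on_frechet[OF y]] that])
  have vel: "velocity AM \<alpha> s = coord_vec AM c (\<alpha> s) (y' s)" if "s \<in> J" for s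
    unfolding y'_def y_def
    by (rule velocity_coord_vec[OF M c J(1) that \<alpha>c]) (use curve dy[OF that] in \<open>auto simp: smooth_curve_def y_def\<close>)
  have quad: "hM (\<alpha> s) (coord_vec AM c (\<alpha> s) v) (coord_vec AM c (\<alpha> s) w) = metric_quad (h c (y s)) v w"
    if "s \<in> J" for s v w
    using induced_metric_coord_vec[OF c \<alpha>c[OF that]] by (simp add: y_def)
  have unit: "metric_quad (h c (y s)) (y' s) (y' s) = 1" if "s \<in> J" for s
  proof -
    have "sqrt (hM (\<alpha> s) (velocity AM \<alpha> s) (velocity AM \<alpha> s)) = 1"
      using arc that by (simp add: arclength_parametrized_def tnorm_def)
    then show ?thesis unfolding vel[OF that] quad[OF that] by simp
  qed
  define Q where "Q s = metric_quad (h c (y s)) (y' s) (axis 2 1)" for s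
  \<comment> \<open>The second coordinate vector represents \<open>X\<close>, so the angle condition
    evaluates the conserved product at unit speed.\<close>
  have Q: "Q s = sqrt (h c (y s) $ 2 $ 2) * cos \<theta>" if "s \<in> J" for s
  proof -
    note K = invariant_chart_killing[OF psi \<gamma> \<alpha>c[OF that]]
    have "g (f (\<alpha> s)) (differential AM AN f (\<alpha> s) (velocity AM \<alpha> s)) (X (f (\<alpha> s))) =
      tnorm g (f (\<alpha> s)) (differential AM AN f (\<alpha> s) (velocity AM \<alpha> s)) * tnorm g (f (\<alpha> s)) (X (f (\<alpha> s))) * cos \<theta>"
      using lox that unfolding loxodrome_def Let_def by blast
    then have "metric_quad (h c (y s)) (y' s) (axis 2 1) =
        sqrt (metric_quad (h c (y s)) (y' s) (y' s)) * sqrt (h c (y s) $ 2 $ 2) * cos \<theta>"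
      unfolding K[symmetric] tnorm_def vel[OF that] induced_metric_def[symmetric] quad[OF that] metric_quad_axis .
    then show ?thesis by (simp add: Q_def unit[OF that])
  qed
  have Q': "(Q has_real_derivative 0) (at s)" if "s \<in> J" for s
    unfolding Q_def[abs_def] y'_def
  proof (rule clairaut)
    show "(\<lambda>z. h c z $ i $ j) differentiable (at (y s))" for i j
      by (rule smooth_on_differentiable[OF metric_smooth[OF c] yim[OF that]])
    show "h c (y s) $ i $ j = h c (y s) $ j $ i" for i j by (rule metric_sym[OF c yim[OF that]])
    show "det (h c (y s)) \<noteq> 0" by (rule metric_det[OF c yim[OF that]])
    show "partial 2 (\<lambda>z. h c z $ i $ j) (y s) = 0" for i j by (rule invariant_chart_partial[OF psi \<gamma> yim[OF that]])
    show "y differentiable (at s)" "(\<lambda>t. vector_derivative y (at t)) differentiable (at s)"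
      using dy[OF that] dy'[OF that] by (simp_all add: y'_def)
    show "vector_derivative (\<lambda>t. vector_derivative y (at t)) (at s) $ k +
       (\<Sum>i\<in>UNIV. \<Sum>j\<in>UNIV. christoffel (h c) (y s) k i j * vector_derivative y (at s) $ i * vector_derivative y (at s) $ j) = 0" for k
      using geod c that \<alpha>c[OF that] unfolding geodesic_def Let_def y_def by blast
  qed
  have G: "h c (y s) $ 2 $ 2 = h c (y s\<^sub>0) $ 2 $ 2" if "s \<in> J" for s
  proof -
    have "Q s = Q s\<^sub>0"
      by (rule has_derivative_zero_unique_connected[OF J _ that s0])
        (rule has_derivative_eq_rhs[OF Q'[unfolded has_field_derivative_def]], simp_all add: fun_eq_iff)
    then show ?thesis using Q[OF that] Q[OF s0] \<theta> by simp
  qed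
  then show "\<exists>G\<^sub>0. \<forall>s\<in>J. h c (y s) $ 2 $ 2 = G\<^sub>0" by blast
  \<comment> \<open>Otherwise the unit velocity is a multiple of the Killing direction, which forces
    the cosine of the angle to have square 1, against the nonzero sine.\<close>
  have "y' s\<^sub>0 $ 1 \<noteq> 0"
  proof
    assume 0: "y' s\<^sub>0 $ 1 = 0"
    define G where "G = h c (y s\<^sub>0) $ 2 $ 2"
    define x where "x = y' s\<^sub>0 $ 2"
    have G0: "G > 0" unfolding G_def by (rule metric_22_pos[OF c yim[OF s0]])
    have 1: "G * x * x = 1" using unit[OF s0] by (simp add: metric_quad_def sum_2 0 G_def x_def)
    have "G * x = sqrt G * cos \<theta>"
      using Q[OF s0] by (simp add: Q_def metric_quad_def sum_2 0 G_def x_def axis_def)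
    then have "(G * x) * (G * x) = (sqrt G * sqrt G) * (cos \<theta>)\<^sup>2" by (simp add: power2_eq_square)
    then have "G * (G * x * x) = G * (cos \<theta>)\<^sup>2" using G0 by (simp add: mult_ac)
    then have "(cos \<theta>)\<^sup>2 = 1" using G0 1 by simp
    then show False using sin_cos_squared_add[of \<theta>] \<theta> by simp
  qed
  moreover have "((\<lambda>s. y s $ 1) has_real_derivative y' s\<^sub>0 $ 1) (at s\<^sub>0)"
    using bounded_linear.has_vector_derivative[OF bounded_linear_vec_nth, of y "y' s\<^sub>0"] dy[OF s0]
    by (simp add: has_real_derivative_iff_has_vector_derivative y'_def vector_derivative_works)
  moreover have "continuous_on J (\<lambda>s. y s $ 1)"
    using Ck_on_nth[OF J(1) smooth_on_imp_Ck[OF y, of 0], of 1] by simp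
  ultimately show "\<exists>a b. y s\<^sub>0 $ 1 \<in> {a<..<b} \<and> {a<..<b} \<subseteq> (\<lambda>s. y s $ 1) ` J"
    using derivative_nonzero_image_nhd[OF J s0] by (metis greaterThanLessThan_iff)
qed

end

theorem theorem3p1:
  fixes TN :: "'n topology" and AN :: "('n, 3) chart set" and g :: "('n, 3) metric_tensor"
    and X :: "('n, 3) vfield" and \<phi> :: "real \<Rightarrow> 'n \<Rightarrow> 'n"
    and TB :: "'n set topology" and AB :: "('n set, 2) chart set" and gB :: "('n set, 2) metric_tensor"
    and TM :: "'m topology" and AM :: "('m, 2) chart set" and f :: "'m \<Rightarrow> 'n"
    and \<tau> :: "real \<Rightarrow> 'm \<Rightarrow> 'm"
    and I J :: "real set" and \<epsilon> :: real and \<gamma>B :: "real \<Rightarrow> 'n set" and \<gamma> :: "real \<Rightarrow> 'n"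
    and c :: "('m, 2) chart" and \<alpha> :: "real \<Rightarrow> 'm" and u v :: "real \<Rightarrow> real" and \<theta>\<^sub>0 :: real
  assumes N: "riemannian_manifold TN AN g"
    and X: "killing_field TN AN g X"
    and flow: "flow_of TN AN X \<phi>"
    and orbit_space: "riemannian_orbit_space TN AN g \<phi> TB AB gB"
    and M: "invariant_surface TN AN \<phi> TM AM f \<tau>"
    and I: "open_interval I" and eps: "\<epsilon> > 0"
    and profile: "profile_lift TN AN \<phi> TB AB gB I \<gamma>B \<gamma>"
    and psi: "invariant_chart \<phi> AM f I \<epsilon> \<gamma> c"
    and J: "open_interval J"
    and alpha: "\<forall>s\<in>J. \<alpha> s \<in> fst c \<and> snd c (\<alpha> s) = vector [u s, v s]"
    and lox: "loxodrome AN g X TM AM f J \<alpha> \<theta>\<^sub>0"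
    and arclength: "arclength_parametrized AM (induced_metric AM AN f g) J \<alpha>"
    and angle: "\<theta>\<^sub>0 \<in> {0..<pi}" "\<theta>\<^sub>0 \<noteq> 0" "\<theta>\<^sub>0 \<noteq> pi / 2"
    and geod: "geodesic AM (induced_metric AM AN f g) J \<alpha>"
  shows "flat_on AM (induced_metric AM AN f g) (\<Union>s\<in>J. orbit \<tau> (\<alpha> s))"
proof -
  have \<tau>: "smooth_real_action TM AM \<tau>" and equi: "\<And>t x. x \<in> topspace TM \<Longrightarrow> f (\<tau> t x) = \<phi> t (f x)"
    using M by (auto simp: invariant_surface_def)
  interpret immersed_in_killing_manifold TN AN g X \<phi> TM AM f
    by unfold_locales (use N X flow M in \<open>auto simp: invariant_surface_def\<close>)
  have \<gamma>: "\<gamma> ` I \<subseteq> topspace TN"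
    using profile by (auto simp: profile_lift_def regular_part_def)
  have im: "snd c ` fst c = {z. z $ 1 \<in> I \<and> z $ 2 \<in> {-\<epsilon><..<\<epsilon>}}"
    using psi by (auto simp: invariant_chart_def)
  have Jo: "open J" and Jc: "connected J" using J by (auto simp: open_interval_def)
  have \<alpha>c: "\<alpha> s \<in> fst c" if "s \<in> J" for s using alpha that by blast
  have sin: "sin \<theta>\<^sub>0 \<noteq> 0" using sin_gt_zero[of \<theta>\<^sub>0] angle by auto
  have cos: "cos \<theta>\<^sub>0 \<noteq> 0"
  proof
    assume "cos \<theta>\<^sub>0 = 0"
    then have "cos \<theta>\<^sub>0 = cos (pi / 2)" by simp
    then show False using cos_inj_pi[of \<theta>\<^sub>0 "pi / 2"] angle by auto
  qed
  have "gauss_curvature AM hM (\<tau> t (\<alpha> s)) = 0" if s: "s \<in> J" for s t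
  proof -
    note geo = geodesic_loxodrome[OF psi \<gamma> Jo Jc \<alpha>c lox arclength cos sin geod s]
    obtain G\<^sub>0 where G0: "\<And>s. s \<in> J \<Longrightarrow> h c (snd c (\<alpha> s)) $ 2 $ 2 = G\<^sub>0"
      using geo(1) by auto
    obtain a b where ab: "snd c (\<alpha> s) $ 1 \<in> {a<..<b}" "{a<..<b} \<subseteq> (\<lambda>s. snd c (\<alpha> s) $ 1) ` J"
      using geo(2) by auto
    have \<alpha>im: "snd c (\<alpha> s) \<in> snd c ` fst c" if "s \<in> J" for s using \<alpha>c[OF that] by simp
    show ?thesis
    proof (rule gauss_curvature_orbit_zero[OF psi \<gamma> eps \<tau> equi _ \<alpha>c[OF s] ab(1)])
      show "{a<..<b} \<subseteq> I" using ab(2) \<alpha>im unfolding im by auto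
      fix z assume z: "z \<in> snd c ` fst c" "z $ 1 \<in> {a<..<b}"
      \<comment> \<open>Every first coordinate in the interval is attained by the curve at some
        parameter \<open>r\<close>; as the metric ignores the second coordinate, the value of
        \<open>\<omega>\<close> squared on the curve is also the value at \<open>z\<close>.\<close>
      then obtain r where r: "r \<in> J" "z $ 1 = snd c (\<alpha> r) $ 1" using ab(2) by blast
      show "h c z $ 2 $ 2 = G\<^sub>0"
        using invariant_chart_metric[OF psi \<gamma> \<alpha>im[OF r(1)] z(1) r(2)] G0[OF r(1)] by simp
    qed
  qed
  then show ?thesis by (auto simp: flat_on_def orbit_def)
qed

end
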